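(* Let $K$ be a number field with $s\geq 1$ real embeddings $\sigma_1,\dots,\sigma_s:K\hookrightarrow\mathbb{R}$ and $2t\geq 2$ non-real complex embeddings, labelled $\sigma_{s+1},\dots,\sigma_{s+2t}:K\hookrightarrow\mathbb{C}$ so that $\sigma_{s+t+k}=\overline{\sigma_{s+k}}$ for $k=1,\dots,t$. Let $\mathcal{O}_K^*$ denote the group of units of the ring of integers $\mathcal{O}_K$ of $K$. Suppose $U\subseteq \mathcal{O}_K^*$ is a subgroup of rank $s$ (as an abelian group) such that for every $u\in U$ one has $|\sigma_{s+i}(u)|=|\sigma_{s+j}(u)|$ for all $i,j\in\{1,\dots,t\}$. Then $t=1$.
   Context: The pair $(s,t)$ is the signature of $K$: $s$ is the number of real embeddings and $2t$ the number of non-real complex embeddings of $K$ into $\mathbb{C}$, so $[K:\mathbb{Q}]=s+2t$. The rank of $U$ is its $\mathbb{Z}$-rank, i.e. $\dim_{\mathbb{Q}}(U\otimes_{\mathbb{Z}}\mathbb{Q})$. *)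

theory Defs
  imports
    "HOL-Analysis.Analysis"
    "HOL-Algebra.Free_Abelian_Groups"
    "HOL-Algebra.Generated_Groups"
    "Jordan_Normal_Form.VS_Connect"
begin

definition number_field :: "'a::field_char_0 itself \<Rightarrow> bool" where
  "number_field TYPE('a) \<longleftrightarrow>
     (\<exists>B::'a set. finite B \<and> Modules.module.span (\<lambda>(q::rat) x. of_rat q * x) B = UNIV)"

definition ring_of_integers :: "'a::field_char_0 ring" where
  "ring_of_integers =
     \<lparr>carrier = {x. algebraic_int x}, monoid.mult = (*), one = 1, zero = 0, add = (+)\<rparr>"

definition real_embeddings :: "('a::field_char_0 \<Rightarrow> complex) set" where
  "real_embeddings = {f. field_hom f \<and> range f \<subseteq> \<real>}"

definition nonreal_embeddings :: "('a::field_char_0 \<Rightarrow> complex) set" where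
  "nonreal_embeddings = {f. field_hom f \<and> \<not> range f \<subseteq> \<real>}"

text \<open>The tensor product over the integers of a (multiplicatively written) commutative group
  \<open>G\<close> with the additive group of the rationals: the free Abelian group on the pairs \<open>(g, q)\<close>
  modulo the subgroup generated by the bilinearity relations. The class of \<open>frag_of (g, q)\<close> is
  the pure tensor of \<open>g\<close> and \<open>q\<close>, and a rational \<open>r\<close> acts by sending it to the class of
  \<open>frag_of (g, r * q)\<close>.\<close>

definition tensor_rat_relations :: "('a, 'm) monoid_scheme \<Rightarrow> ('a \<times> rat \<Rightarrow>\<^sub>0 int) set" where
  "tensor_rat_relations G =
     {frag_of (g \<otimes>\<^bsub>G\<^esub> h, q) - (frag_of (g, q) + frag_of (h, q)) | g h q.
        g \<in> carrier G \<and> h \<in> carrier G} \<union>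
     {frag_of (g, q + r) - (frag_of (g, q) + frag_of (g, r)) | g q r. g \<in> carrier G}"

definition tensor_rat_free :: "('a, 'm) monoid_scheme \<Rightarrow> ('a \<times> rat \<Rightarrow>\<^sub>0 int) monoid" where
  "tensor_rat_free G = free_Abelian_group (carrier G \<times> UNIV)"

definition tensor_rat_kernel :: "('a, 'm) monoid_scheme \<Rightarrow> ('a \<times> rat \<Rightarrow>\<^sub>0 int) set" where
  "tensor_rat_kernel G = generate (tensor_rat_free G) (tensor_rat_relations G)"

definition tensor_rat_scale :: "rat \<Rightarrow> ('a \<times> rat \<Rightarrow>\<^sub>0 int) \<Rightarrow> ('a \<times> rat \<Rightarrow>\<^sub>0 int)" where
  "tensor_rat_scale r = frag_extend (\<lambda>(g, q). frag_of (g, r * q))"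

text \<open>The fields \<open>mult\<close> and \<open>one\<close> of a module record are not used by the vector space
  structure.\<close>

definition tensor_rat ::
    "('a, 'm) monoid_scheme \<Rightarrow> (rat, ('a \<times> rat \<Rightarrow>\<^sub>0 int) set) module" where
  "tensor_rat G =
     \<lparr>carrier = carrier (tensor_rat_free G Mod tensor_rat_kernel G),
      monoid.mult = undefined, one = undefined,
      zero = \<one>\<^bsub>tensor_rat_free G Mod tensor_rat_kernel G\<^esub>,
      add = (\<otimes>\<^bsub>tensor_rat_free G Mod tensor_rat_kernel G\<^esub>),
      smult = (\<lambda>r C. \<Union>c\<in>C. tensor_rat_kernel G #>\<^bsub>tensor_rat_free G\<^esub> tensor_rat_scale r c)\<rparr>"

text \<open>Finite dimensionality is stated explicitly because \<open>vectorspace.dim\<close> is unspecified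
  without it.\<close>

definition has_Z_rank :: "('a, 'm) monoid_scheme \<Rightarrow> nat \<Rightarrow> bool" where
  "has_Z_rank G n \<longleftrightarrow>
     vectorspace.fin_dim class_ring (tensor_rat G) \<and>
     vectorspace.dim class_ring (tensor_rat G) = n"

lemma tensor_rat_relations_subset:
  assumes "monoid G"
  shows "tensor_rat_relations G \<subseteq> carrier (tensor_rat_free G)"
proof -
  interpret monoid G by fact
  show ?thesis
    by (auto simp: tensor_rat_relations_def tensor_rat_free_def keys_frag_of
             dest!: subsetD[OF keys_diff] subsetD[OF keys_add])
qed

lemma comm_group_tensor_rat_free: "comm_group (tensor_rat_free G)"
  by (simp add: tensor_rat_free_def abelian_free_Abelian_group)

lemma subgroup_tensor_rat_kernel:
  assumes "monoid G"
  shows "subgroup (tensor_rat_kernel G) (tensor_rat_free G)"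
proof -
  interpret F: comm_group "tensor_rat_free G" by (rule comm_group_tensor_rat_free)
  show ?thesis
    using F.generate_is_subgroup[OF tensor_rat_relations_subset[OF assms]]
    by (simp add: tensor_rat_kernel_def)
qed

lemma tensor_rat_kernel_add:
  "a \<in> tensor_rat_kernel G \<Longrightarrow> b \<in> tensor_rat_kernel G \<Longrightarrow> a + b \<in> tensor_rat_kernel G"
  using generate.eng[of a "tensor_rat_free G" "tensor_rat_relations G" b]
  by (simp add: tensor_rat_kernel_def tensor_rat_free_def)

lemma tensor_rat_kernel_zero: "0 \<in> tensor_rat_kernel G"
  using generate.one[of "tensor_rat_free G" "tensor_rat_relations G"]
  by (simp add: tensor_rat_kernel_def tensor_rat_free_def)

lemma tensor_rat_kernel_uminus:
  assumes "monoid G" "a \<in> tensor_rat_kernel G"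
  shows "- a \<in> tensor_rat_kernel G"
proof -
  have "a \<in> carrier (tensor_rat_free G)"
    using subgroup.subset[OF subgroup_tensor_rat_kernel[OF assms(1)]] assms(2) by blast
  then show ?thesis
    using subgroup.m_inv_closed[OF subgroup_tensor_rat_kernel[OF assms(1)] assms(2)]
    by (simp add: tensor_rat_free_def)
qed

lemma tensor_rat_scale_closed:
  assumes "c \<in> carrier (tensor_rat_free G)"
  shows "tensor_rat_scale r c \<in> carrier (tensor_rat_free G)"
proof -
  have c: "Poly_Mapping.keys c \<subseteq> carrier G \<times> UNIV"
    using assms by (simp add: tensor_rat_free_def)
  have "(\<Union>x\<in>Poly_Mapping.keys c. Poly_Mapping.keys ((\<lambda>(g, q). frag_of (g, r * q)) x))
      \<subseteq> carrier G \<times> UNIV"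
  proof (rule UN_least)
    fix x assume "x \<in> Poly_Mapping.keys c"
    with c have "fst x \<in> carrier G" by auto
    then show "Poly_Mapping.keys ((\<lambda>(g, q). frag_of (g, r * q)) x) \<subseteq> carrier G \<times> UNIV"
      by (simp add: case_prod_unfold)
  qed
  with keys_frag_extend[of "\<lambda>(g, q). frag_of (g, r * q)" c]
  have "Poly_Mapping.keys (tensor_rat_scale r c) \<subseteq> carrier G \<times> UNIV"
    unfolding tensor_rat_scale_def by (rule order_trans)
  then show ?thesis by (simp add: tensor_rat_free_def)
qed

lemma tensor_rat_scale_add:
  "tensor_rat_scale r (c + d) = tensor_rat_scale r c + tensor_rat_scale r d"
  by (simp add: tensor_rat_scale_def frag_extend_add)

lemma tensor_rat_scale_kernel:
  assumes "monoid G" "c \<in> tensor_rat_kernel G"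
  shows "tensor_rat_scale r c \<in> tensor_rat_kernel G"
proof -
  have rel: "tensor_rat_scale r h \<in> tensor_rat_relations G" if "h \<in> tensor_rat_relations G" for h
    using that unfolding tensor_rat_relations_def
    by (auto simp: tensor_rat_scale_def frag_extend_diff frag_extend_add ring_distribs) blast+
  have "c \<in> generate (tensor_rat_free G) (tensor_rat_relations G)"
    using assms(2) by (simp add: tensor_rat_kernel_def)
  then show ?thesis
  proof induction
    case one
    show ?case using tensor_rat_kernel_zero[of G] by (simp add: tensor_rat_free_def tensor_rat_scale_def)
  next
    case (incl h)
    then show ?case using rel by (auto simp: tensor_rat_kernel_def intro: generate.incl)
  next
    case (inv h)
    then have "inv\<^bsub>tensor_rat_free G\<^esub> h = - h"
      using tensor_rat_relations_subset[OF assms(1)] by (auto simp: tensor_rat_free_def)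
    moreover have "tensor_rat_scale r h \<in> tensor_rat_kernel G"
      using inv rel by (auto simp: tensor_rat_kernel_def intro: generate.incl)
    ultimately show ?case
      using tensor_rat_kernel_uminus[OF assms(1)]
      by (simp add: tensor_rat_scale_def frag_extend_minus)
  next
    case (eng h1 h2)
    then show ?case
      using tensor_rat_kernel_add
      by (simp add: tensor_rat_free_def tensor_rat_scale_def frag_extend_add)
  qed
qed

lemma tensor_rat_coset_eqI:
  assumes "monoid G" "c \<in> carrier (tensor_rat_free G)" "d \<in> carrier (tensor_rat_free G)"
    and "d - c \<in> tensor_rat_kernel G"
  shows "tensor_rat_kernel G #>\<^bsub>tensor_rat_free G\<^esub> c = tensor_rat_kernel G #>\<^bsub>tensor_rat_free G\<^esub> d"
proof -
  interpret F: comm_group "tensor_rat_free G" by (rule comm_group_tensor_rat_free)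
  have "d \<in> tensor_rat_kernel G #>\<^bsub>tensor_rat_free G\<^esub> c"
    using assms(4) by (force simp: r_coset_def tensor_rat_free_def)
  then show ?thesis
    using F.repr_independence subgroup_tensor_rat_kernel[OF assms(1)] assms(2) by blast
qed

lemma tensor_rat_smult_coset:
  assumes "monoid G" "c \<in> carrier (tensor_rat_free G)"
  shows "r \<odot>\<^bsub>tensor_rat G\<^esub> (tensor_rat_kernel G #>\<^bsub>tensor_rat_free G\<^esub> c) =
         tensor_rat_kernel G #>\<^bsub>tensor_rat_free G\<^esub> tensor_rat_scale r c"
proof -
  interpret F: comm_group "tensor_rat_free G" by (rule comm_group_tensor_rat_free)
  let ?C = "tensor_rat_kernel G #>\<^bsub>tensor_rat_free G\<^esub> c"
  have "tensor_rat_kernel G #>\<^bsub>tensor_rat_free G\<^esub> tensor_rat_scale r d =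
        tensor_rat_kernel G #>\<^bsub>tensor_rat_free G\<^esub> tensor_rat_scale r c" if dC: "d \<in> ?C" for d
  proof -
    obtain n where n: "n \<in> tensor_rat_kernel G" "d = n + c"
      using dC by (auto simp: r_coset_def tensor_rat_free_def)
    have "n \<in> carrier (tensor_rat_free G)"
      using n subgroup.subset[OF subgroup_tensor_rat_kernel[OF assms(1)]] by blast
    then have d: "d \<in> carrier (tensor_rat_free G)"
      using F.m_closed[OF _ assms(2)] n by (simp add: tensor_rat_free_def)
    have "tensor_rat_scale r d - tensor_rat_scale r c \<in> tensor_rat_kernel G"
      using tensor_rat_scale_kernel[OF assms(1) n(1)] n(2)
      by (simp add: tensor_rat_scale_def frag_extend_add)
    then show ?thesis
      using tensor_rat_coset_eqI[OF assms(1)] tensor_rat_scale_closed d assms(2) by metis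
  qed
  then have "(\<Union>d\<in>?C. tensor_rat_kernel G #>\<^bsub>tensor_rat_free G\<^esub> tensor_rat_scale r d) =
      (\<Union>d\<in>?C. tensor_rat_kernel G #>\<^bsub>tensor_rat_free G\<^esub> tensor_rat_scale r c)"
    by (rule SUP_cong[OF refl])
  moreover have "c \<in> ?C"
    using F.rcos_self[OF assms(2) subgroup_tensor_rat_kernel[OF assms(1)]] .
  then have "?C \<noteq> {}" by blast
  ultimately show ?thesis by (simp only: tensor_rat_def module.simps UN_constant if_False)
qed

lemma vectorspace_tensor_rat:
  assumes "comm_group G"
  shows "vectorspace (class_ring :: rat ring) (tensor_rat G)"
proof -
  interpret G: comm_group G by fact
  have m: "monoid G" ..
  interpret F: comm_group "tensor_rat_free G" by (rule comm_group_tensor_rat_free)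
  define F where "F = tensor_rat_free G"
  define N where "N = tensor_rat_kernel G"
  have sub: "subgroup N F" unfolding F_def N_def by (rule subgroup_tensor_rat_kernel[OF m])
  interpret N: normal N F
    using sub F.normal_iff_subgroup by (simp add: F_def)
  have comm: "comm_group (F Mod N)"
    using sub F.abelian_FactGroup by (simp add: F_def)
  interpret Q: comm_group "F Mod N" by fact
  have car: "carrier (tensor_rat G) = (\<lambda>c. N #>\<^bsub>F\<^esub> c) ` carrier F"
    by (simp add: tensor_rat_def F_def N_def carrier_FactGroup)
  have add: "(N #>\<^bsub>F\<^esub> c) \<oplus>\<^bsub>tensor_rat G\<^esub> (N #>\<^bsub>F\<^esub> d) = N #>\<^bsub>F\<^esub> (c + d)"
    if "c \<in> carrier F" "d \<in> carrier F" for c d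
    using N.rcos_sum[OF that] by (simp add: tensor_rat_def F_def N_def tensor_rat_free_def)
  have scale: "r \<odot>\<^bsub>tensor_rat G\<^esub> (N #>\<^bsub>F\<^esub> c) = N #>\<^bsub>F\<^esub> tensor_rat_scale r c"
    if "c \<in> carrier F" for r c
    using tensor_rat_smult_coset[OF m] that by (simp add: F_def N_def)
  have cl: "tensor_rat_scale r c \<in> carrier F" if "c \<in> carrier F" for r c
    using tensor_rat_scale_closed that by (simp add: F_def)
  have pl: "c + d \<in> carrier F" if "c \<in> carrier F" "d \<in> carrier F" for c d
    using F.m_closed that by (simp add: F_def tensor_rat_free_def)
  have eqI: "N #>\<^bsub>F\<^esub> c = N #>\<^bsub>F\<^esub> d" if "c \<in> carrier F" "d \<in> carrier F" "d - c \<in> N" for c d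
    using tensor_rat_coset_eqI[OF m] that by (simp add: F_def N_def)
  have ab: "abelian_group (tensor_rat G)"
  proof (rule abelian_groupI)
    have r: "carrier (tensor_rat G) = carrier (F Mod N)" "\<zero>\<^bsub>tensor_rat G\<^esub> = \<one>\<^bsub>F Mod N\<^esub>"
      "add (tensor_rat G) = monoid.mult (F Mod N)"
      by (simp_all add: tensor_rat_def F_def N_def)
    fix x y z
    assume x: "x \<in> carrier (tensor_rat G)"
    show "\<exists>y\<in>carrier (tensor_rat G). y \<oplus>\<^bsub>tensor_rat G\<^esub> x = \<zero>\<^bsub>tensor_rat G\<^esub>"
      using x Q.l_inv_ex unfolding r by blast
    show "\<zero>\<^bsub>tensor_rat G\<^esub> \<oplus>\<^bsub>tensor_rat G\<^esub> x = x"
      using x unfolding r by (rule Q.l_one)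
    assume y: "y \<in> carrier (tensor_rat G)"
    show "x \<oplus>\<^bsub>tensor_rat G\<^esub> y \<in> carrier (tensor_rat G)"
      using x y unfolding r by (rule Q.m_closed)
    show "x \<oplus>\<^bsub>tensor_rat G\<^esub> y = y \<oplus>\<^bsub>tensor_rat G\<^esub> x"
      using x y unfolding r by (rule Q.m_comm)
    assume z: "z \<in> carrier (tensor_rat G)"
    show "x \<oplus>\<^bsub>tensor_rat G\<^esub> y \<oplus>\<^bsub>tensor_rat G\<^esub> z = x \<oplus>\<^bsub>tensor_rat G\<^esub> (y \<oplus>\<^bsub>tensor_rat G\<^esub> z)"
      using x y z unfolding r by (rule Q.m_assoc)
  next
    show "\<zero>\<^bsub>tensor_rat G\<^esub> \<in> carrier (tensor_rat G)"
      using Q.one_closed by (simp add: tensor_rat_def F_def N_def)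
  qed
  have dist: "tensor_rat_scale a c + tensor_rat_scale b c - tensor_rat_scale (a + b) c \<in> N"
    if "c \<in> carrier F" for a b c
  proof -
    have "Poly_Mapping.keys c \<subseteq> carrier G \<times> UNIV"
      using that by (simp add: F_def tensor_rat_free_def)
    then show ?thesis
    proof (induction c rule: frag_induction)
      case zero
      then show ?case using tensor_rat_kernel_zero[of G] by (simp add: tensor_rat_scale_def N_def)
    next
      case (one x)
      obtain g q where x: "x = (g, q)" "g \<in> carrier G" using one by auto
      have "frag_of (g, a * q + b * q) - (frag_of (g, a * q) + frag_of (g, b * q)) \<in> tensor_rat_relations G"
        unfolding tensor_rat_relations_def using x by blast
      then have "frag_of (g, a * q + b * q) - (frag_of (g, a * q) + frag_of (g, b * q)) \<in> N"
        by (simp add: N_def tensor_rat_kernel_def generate.incl)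
      then have "- (frag_of (g, a * q + b * q) - (frag_of (g, a * q) + frag_of (g, b * q))) \<in> N"
        using tensor_rat_kernel_uminus[OF m] by (simp only: N_def)
      then show ?case by (simp add: x tensor_rat_scale_def ring_distribs)
    next
      case (diff c d)
      have "(tensor_rat_scale a c + tensor_rat_scale b c - tensor_rat_scale (a + b) c)
         + - (tensor_rat_scale a d + tensor_rat_scale b d - tensor_rat_scale (a + b) d) \<in> N"
        using diff tensor_rat_kernel_add tensor_rat_kernel_uminus[OF m] unfolding N_def by blast
      then show ?case by (simp add: tensor_rat_scale_def frag_extend_diff algebra_simps)
    qed
  qed
  have scale_mult: "tensor_rat_scale (a * b) c = tensor_rat_scale a (tensor_rat_scale b c)" for a b c
    unfolding tensor_rat_scale_def
    using frag_extend_compose[of "\<lambda>(g, q). frag_of (g, a * q)" "\<lambda>(g, q). (g, b * q)" c]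
    by (simp add: comp_def case_prod_unfold mult.assoc)
  have scale_1: "tensor_rat_scale 1 c = c" for c
    by (simp add: tensor_rat_scale_def case_prod_unfold flip: frag_expansion)
  have "Module.module (class_ring :: rat ring) (tensor_rat G)"
  proof (rule moduleI)
    show "cring (class_ring :: rat ring)" by (rule class_cring.cring_axioms)
    show "abelian_group (tensor_rat G)" by (rule ab)
    fix a b :: rat and x y
    show "a \<odot>\<^bsub>tensor_rat G\<^esub> x \<in> carrier (tensor_rat G)" if "x \<in> carrier (tensor_rat G)"
      using that cl scale by (auto simp: car)
    show "(a \<oplus>\<^bsub>class_ring\<^esub> b) \<odot>\<^bsub>tensor_rat G\<^esub> x =
        a \<odot>\<^bsub>tensor_rat G\<^esub> x \<oplus>\<^bsub>tensor_rat G\<^esub> b \<odot>\<^bsub>tensor_rat G\<^esub> x" if "x \<in> carrier (tensor_rat G)"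
    proof -
      obtain c where c: "c \<in> carrier F" "x = N #>\<^bsub>F\<^esub> c"
        using \<open>x \<in> carrier (tensor_rat G)\<close> by (auto simp: car)
      show ?thesis
        using eqI[OF cl[OF c(1)] pl[OF cl[OF c(1)] cl[OF c(1)]] dist[OF c(1)], of a b]
        by (simp add: c scale add cl)
    qed
    show "a \<odot>\<^bsub>tensor_rat G\<^esub> (x \<oplus>\<^bsub>tensor_rat G\<^esub> y) =
        a \<odot>\<^bsub>tensor_rat G\<^esub> x \<oplus>\<^bsub>tensor_rat G\<^esub> a \<odot>\<^bsub>tensor_rat G\<^esub> y"
      if "x \<in> carrier (tensor_rat G)" "y \<in> carrier (tensor_rat G)"
      using that by (auto simp: car scale add cl pl tensor_rat_scale_add)
    show "(a \<otimes>\<^bsub>class_ring\<^esub> b) \<odot>\<^bsub>tensor_rat G\<^esub> x =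
        a \<odot>\<^bsub>tensor_rat G\<^esub> (b \<odot>\<^bsub>tensor_rat G\<^esub> x)" if "x \<in> carrier (tensor_rat G)"
      using that by (auto simp: car scale cl scale_mult)
    show "\<one>\<^bsub>class_ring\<^esub> \<odot>\<^bsub>tensor_rat G\<^esub> x = x" if "x \<in> carrier (tensor_rat G)"
      using that by (auto simp: car scale scale_1)
  qed
  then show ?thesis
    by (simp add: vectorspace_def class_field.field_axioms)
qed

end

theory Submission
  imports Defs "Berlekamp_Zassenhaus.Factor_Bound"
begin

text \<open>Suppose \<open>t \<ge> 2\<close>, and write \<open>a j u = ln |\<sigma> j u|\<close>. On \<open>U\<close> all \<open>a j\<close> with \<open>j > s\<close> coincide with one
  character \<open>b\<close>, and the norm being \<open>\<plusminus>1\<close> gives \<open>a 1 + \<dots> + a s + 2 t b = 0\<close>.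
  The hypothesis on the absolute values says
  \<open>\<sigma>(s+1) u \<cdot> \<sigma>(s+t+1) u = \<sigma>(s+2) u \<cdot> \<sigma>(s+t+2) u\<close>. Apply to this a homomorphism \<open>\<tau>\<close> with
  \<open>\<tau> \<circ> \<sigma>(s+1) = \<sigma> 1\<close> defined on a field containing the images of all embeddings; it permutes the
  embeddings. Taking logarithms, \<open>a 1\<close> plus one of the other \<open>a j\<close> is the sum of two others, and
  eliminating \<open>b\<close> leaves \<open>a 1\<close> with a coefficient of at least \<open>1 - 1/(2t)\<close>. Hence
  \<open>a 2, \<dots>, a s\<close> already control all \<open>a j\<close>. As an algebraic integer with bounded conjugates is
  one of finitely many, \<open>(a 2, \<dots>, a s)\<close> maps \<open>U\<close> with finite kernel onto a discrete subgroup of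
  a real space of dimension \<open>s - 1\<close>, so \<open>U\<close> has rank at most \<open>s - 1\<close>.\<close>

section \<open>Subfields and extension of homomorphisms\<close>

hide_const (open) up_ring.coeff up_ring.monom module.smult

text \<open>Subfields are sets inside one ambient type, so that a tower is built by enlarging the
  set. Closure under \<open>inverse\<close> also covers 0, where
  \<open>inverse 0 = 0\<close>.\<close>

locale subfield_set =
  fixes F :: "'a::field set"
  assumes one_mem: "1 \<in> F"
    and diff_mem: "x \<in> F \<Longrightarrow> y \<in> F \<Longrightarrow> x - y \<in> F"
    and mult_mem: "x \<in> F \<Longrightarrow> y \<in> F \<Longrightarrow> x * y \<in> F"
    and inverse_mem: "x \<in> F \<Longrightarrow> inverse x \<in> F"
begin

lemma zero_mem: "0 \<in> F"
  using diff_mem[OF one_mem one_mem] by simp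

lemma uminus_mem: "x \<in> F \<Longrightarrow> - x \<in> F"
  using diff_mem[OF zero_mem] by force

lemma add_mem: "x \<in> F \<Longrightarrow> y \<in> F \<Longrightarrow> x + y \<in> F"
  using diff_mem[of x "- y"] uminus_mem by simp

lemma divide_mem: "x \<in> F \<Longrightarrow> y \<in> F \<Longrightarrow> x / y \<in> F"
  using mult_mem inverse_mem by (simp add: divide_inverse)

lemma sum_mem: "(\<And>i. i \<in> I \<Longrightarrow> f i \<in> F) \<Longrightarrow> sum f I \<in> F"
  by (induction I rule: infinite_finite_induct) (auto intro: zero_mem add_mem)

lemma power_mem: "x \<in> F \<Longrightarrow> x ^ n \<in> F"
  by (induction n) (auto intro: one_mem mult_mem)

lemma of_nat_mem: "of_nat n \<in> F"
  by (induction n) (auto intro: zero_mem one_mem add_mem)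

lemma of_int_mem: "of_int n \<in> F"
  by (cases n rule: int_cases2) (auto intro: of_nat_mem uminus_mem)

end

section \<open>Polynomials with coefficients in a subfield\<close>

definition polys_over :: "'a::field set \<Rightarrow> 'a poly set" where
  "polys_over F = {p. \<forall>i. coeff p i \<in> F}"

context subfield_set
begin

lemma polys_over_0: "0 \<in> polys_over F"
  by (simp add: polys_over_def zero_mem)

lemma polys_over_monom: "c \<in> F \<Longrightarrow> monom c n \<in> polys_over F"
  by (simp add: polys_over_def zero_mem)

lemma polys_over_const: "c \<in> F \<Longrightarrow> [:c:] \<in> polys_over F"
  using polys_over_monom[of c 0] by (simp add: monom_0)

lemma polys_over_pCons: "c \<in> F \<Longrightarrow> p \<in> polys_over F \<Longrightarrow> pCons c p \<in> polys_over F"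
  by (auto simp: polys_over_def coeff_pCons split: nat.split)

lemma polys_over_add: "p \<in> polys_over F \<Longrightarrow> q \<in> polys_over F \<Longrightarrow> p + q \<in> polys_over F"
  by (simp add: polys_over_def add_mem)

lemma polys_over_diff: "p \<in> polys_over F \<Longrightarrow> q \<in> polys_over F \<Longrightarrow> p - q \<in> polys_over F"
  by (simp add: polys_over_def diff_mem)

lemma polys_over_mult: "p \<in> polys_over F \<Longrightarrow> q \<in> polys_over F \<Longrightarrow> p * q \<in> polys_over F"
  by (simp add: polys_over_def coeff_mult sum_mem mult_mem)

lemma polys_over_pderiv: "p \<in> polys_over F \<Longrightarrow> pderiv p \<in> polys_over F"
  using of_nat_mem[of "Suc _"] by (auto simp: polys_over_def coeff_pderiv intro!: mult_mem simp del: of_nat_Suc)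

text \<open>Long division: \<open>e * d\<close> cancels the leading term of \<open>p\<close>, and
  the quotient of the leading coefficients stays in \<open>F\<close>. Running it explicitly keeps
  quotient and remainder over \<open>F\<close>, although the polynomials live over the ambient
  field.\<close>

lemma polys_over_division:
  assumes "p \<in> polys_over F" "d \<in> polys_over F" "d \<noteq> 0"
  shows "\<exists>q\<in>polys_over F. \<exists>r\<in>polys_over F. p = q * d + r \<and> (r = 0 \<or> degree r < degree d)"
  using assms(1)
proof (induction "degree p" arbitrary: p rule: less_induct)
  case less
  show ?case
  proof (cases "p = 0 \<or> degree p < degree d")
    case True
    then show ?thesis using less.prems polys_over_0 by (intro bexI[of _ 0] bexI[of _ p]) auto
  next
    case False
    then have p: "p \<noteq> 0" "degree d \<le> degree p" by auto
    define e where "e = monom (lead_coeff p / lead_coeff d) (degree p - degree d)"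
    have e: "e \<in> polys_over F"
      using less.prems assms(2) by (auto simp: e_def polys_over_def intro: divide_mem zero_mem)
    have e0: "e \<noteq> 0" using p assms(3) by (simp add: e_def)
    have dg: "degree (e * d) = degree p"
      using e0 assms(3) p by (simp add: degree_mult_eq e_def degree_monom_eq)
    have lc: "lead_coeff (e * d) = lead_coeff p"
      using assms(3) p(1) unfolding lead_coeff_mult by (simp add: e_def degree_monom_eq)
    have pe: "p - e * d \<in> polys_over F"
      using less.prems e assms(2) by (simp add: polys_over_diff polys_over_mult)
    show ?thesis
    proof (cases "p = e * d")
      case True
      then show ?thesis using e polys_over_0 by (intro bexI[of _ e] bexI[of _ 0]) auto
    next
      case False
      have "degree (p - e * d) < degree p"
        using False dg lc by (intro degree_less_if_less_eqI) (auto simp: degree_diff_le)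
      from less.hyps[OF this pe] obtain q r where
        "q \<in> polys_over F" "r \<in> polys_over F" "p - e * d = q * d + r" "r = 0 \<or> degree r < degree d"
        by blast
      then show ?thesis
        using e by (intro bexI[of _ "q + e"] bexI[of _ r])
          (auto simp: algebra_simps polys_over_add)
    qed
  qed
qed

end

text \<open>Minimality of the degree takes the place of irreducibility: divisibility by
  \<open>m\<close> and the invertibility of nonzero values at \<open>a\<close> are both derived from
  it.\<close>

locale subfield_minpoly = subfield_set F for F :: "'a::field set" +
  fixes a :: 'a and m :: "'a poly"
  assumes minpoly_over: "m \<in> polys_over F"
    and minpoly_monic: "lead_coeff m = 1"
    and minpoly_root: "poly m a = 0"
    and minpoly_min: "p \<in> polys_over F \<Longrightarrow> poly p a = 0 \<Longrightarrow> p \<noteq> 0 \<Longrightarrow> degree m \<le> degree p"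

lemma (in subfield_set) ex_minpoly:
  assumes "p \<in> polys_over F" "p \<noteq> 0" "poly p a = 0"
  shows "\<exists>m. subfield_minpoly F a m"
proof -
  define P where "P q \<longleftrightarrow> q \<in> polys_over F \<and> q \<noteq> 0 \<and> poly q a = 0" for q
  obtain q where q: "P q" "\<And>r. P r \<Longrightarrow> degree q \<le> degree r"
    using assms ex_has_least_nat[of P p degree] unfolding P_def by blast
  define m where "m = smult (inverse (lead_coeff q)) q"
  have "subfield_minpoly F a m"
  proof
    show "m \<in> polys_over F"
      using q(1) by (auto simp: m_def P_def polys_over_def intro: mult_mem inverse_mem)
    show "lead_coeff m = 1" "poly m a = 0"
      using q(1) by (auto simp: m_def P_def)
    show "degree m \<le> degree r" if "r \<in> polys_over F" "poly r a = 0" "r \<noteq> 0" for r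
      using q that by (auto simp: m_def P_def)
  qed
  then show ?thesis ..
qed

context subfield_minpoly
begin

lemma minpoly_nonzero: "m \<noteq> 0"
  using minpoly_monic by auto

lemma degree_minpoly_pos: "degree m > 0"
proof (rule ccontr)
  assume "\<not> degree m > 0"
  then have "m = [:1:]" using minpoly_monic by (metis degree_0_id neq0_conv)
  then show False using minpoly_root by simp
qed

lemma minpoly_division:
  assumes "p \<in> polys_over F"
  obtains q r where "q \<in> polys_over F" "r \<in> polys_over F" "p = q * m + r"
    "degree r < degree m" "poly r a = poly p a"
  using polys_over_division[OF assms minpoly_over minpoly_nonzero] degree_minpoly_pos minpoly_root
  by fastforce

lemma minpoly_dvd:
  assumes "p \<in> polys_over F" "poly p a = 0"
  shows "\<exists>q\<in>polys_over F. p = q * m"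
proof -
  obtain q r where qr: "q \<in> polys_over F" "r \<in> polys_over F" "p = q * m + r"
    "degree r < degree m" "poly r a = poly p a"
    using minpoly_division[OF assms(1)] .
  then have "r = 0" using minpoly_min[OF qr(2)] assms(2) by (metis not_le)
  then show ?thesis using qr by auto
qed

text \<open>Euclidean descent on the degree. If \<open>p\<close> has at least the degree of
  \<open>m\<close>, it is replaced by its remainder modulo \<open>m\<close>. Otherwise
  \<open>m = q * p + r\<close> shows that \<open>r\<close> takes the value
  \<open>- poly q a * poly p a\<close> at \<open>a\<close>, so an inverse of that value times
  \<open>- poly q a\<close> inverts \<open>poly p a\<close>.\<close>

lemma polys_over_inverse:
  assumes "p \<in> polys_over F" "poly p a \<noteq> 0"
  shows "\<exists>q\<in>polys_over F. poly p a * poly q a = 1"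
  using assms
proof (induction "degree p" arbitrary: p rule: less_induct)
  case less
  have p0: "p \<noteq> 0" using less.prems by auto
  consider "degree p = 0" | "degree m \<le> degree p" | "degree p > 0" "degree p < degree m"
    by linarith
  then show ?case
  proof cases
    case 1
    then have "p = [:coeff p 0:]" using degree_0_id by metis
    moreover have "coeff p 0 \<in> F" using less.prems by (simp add: polys_over_def)
    ultimately have "[:inverse (coeff p 0):] \<in> polys_over F"
      "poly p a * poly [:inverse (coeff p 0):] a = 1"
      using less.prems p0 inverse_mem polys_over_const
      by (simp_all, metis poly_pCons poly_0 mult_zero_right add.right_neutral right_inverse)
    then show ?thesis by blast
  next
    case 2
    obtain q r where qr: "q \<in> polys_over F" "r \<in> polys_over F" "p = q * m + r"
      "degree r < degree m" "poly r a = poly p a"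
      using minpoly_division[OF less.prems(1)] .
    then show ?thesis using less.hyps[of r] less.prems 2 by auto
  next
    case 3
    obtain q r where qr: "q \<in> polys_over F" "r \<in> polys_over F" "m = q * p + r"
      "r = 0 \<or> degree r < degree p"
      using polys_over_division[OF minpoly_over less.prems(1) p0] by blast
    have eq: "poly q a * poly p a + poly r a = 0"
      using minpoly_root unfolding qr(3) by simp
    have q0: "q \<noteq> 0" using 3 qr by auto
    have dq: "degree q < degree m"
    proof -
      have "degree (q * p) = degree q + degree p"
        using q0 p0 by (rule degree_mult_eq)
      moreover have "degree m = degree (q * p)"
        unfolding qr(3) using qr(4) calculation by (auto simp: degree_add_eq_left)
      ultimately show ?thesis using 3 by simp
    qed
    \<comment> \<open>As \<open>p\<close> is nonconstant, \<open>q\<close> has smaller degree than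
      \<open>m\<close> and by minimality cannot vanish at \<open>a\<close>.\<close>
    have "poly r a \<noteq> 0"
    proof
      assume "poly r a = 0"
      then have "poly q a = 0" using eq less.prems by simp
      then show False using minpoly_min[OF qr(1)] q0 dq by simp
    qed
    moreover from this have "degree r < degree p" using qr(4) by auto
    ultimately obtain w where w: "w \<in> polys_over F" "poly r a * poly w a = 1"
      using less.hyps qr(2) by blast
    have "poly p a * poly (0 - q * w) a = 1"
      using eq w(2) by (simp, metis add_eq_0_iff mult.assoc mult.commute mult_minus_left)
    then show ?thesis
      using polys_over_diff[OF polys_over_0 polys_over_mult[OF qr(1) w(1)]] by blast
  qed
qed

end

section \<open>Homomorphisms defined on a subfield and their extension\<close>

locale field_hom_on = subfield_set F for F :: "'a::field set" +
  fixes \<phi> :: "'a \<Rightarrow> 'b::field"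
  assumes hom_on_one: "\<phi> 1 = 1"
    and hom_on_add: "x \<in> F \<Longrightarrow> y \<in> F \<Longrightarrow> \<phi> (x + y) = \<phi> x + \<phi> y"
    and hom_on_mult: "x \<in> F \<Longrightarrow> y \<in> F \<Longrightarrow> \<phi> (x * y) = \<phi> x * \<phi> y"
begin

lemma hom_on_zero: "\<phi> 0 = 0"
  using hom_on_add[OF zero_mem zero_mem] by (metis add_0 add_cancel_right_right)

lemma hom_on_eq_0: "x \<in> F \<Longrightarrow> \<phi> x = 0 \<Longrightarrow> x = 0"
  using hom_on_mult[of x "inverse x"] inverse_mem[of x] hom_on_one by (cases "x = 0") auto

lemma hom_on_sum: "(\<And>i. i \<in> I \<Longrightarrow> f i \<in> F) \<Longrightarrow> \<phi> (sum f I) = (\<Sum>i\<in>I. \<phi> (f i))"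
  by (induction I rule: infinite_finite_induct) (auto simp: hom_on_zero hom_on_add sum_mem)

lemma hom_on_uminus: "x \<in> F \<Longrightarrow> \<phi> (- x) = - \<phi> x"
  using hom_on_add[of x "- x"] uminus_mem[of x] by (simp add: hom_on_zero eq_neg_iff_add_eq_0 add.commute)

lemma map_poly_add_on:
  "p \<in> polys_over F \<Longrightarrow> q \<in> polys_over F \<Longrightarrow> map_poly \<phi> (p + q) = map_poly \<phi> p + map_poly \<phi> q"
  by (intro poly_eqI) (simp add: coeff_map_poly hom_on_zero hom_on_add polys_over_def)

lemma map_poly_diff_on:
  "p \<in> polys_over F \<Longrightarrow> q \<in> polys_over F \<Longrightarrow> map_poly \<phi> (p - q) = map_poly \<phi> p - map_poly \<phi> q"
  using map_poly_add_on[of "p - q" q] polys_over_diff by simp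

lemma map_poly_mult_on:
  "p \<in> polys_over F \<Longrightarrow> q \<in> polys_over F \<Longrightarrow> map_poly \<phi> (p * q) = map_poly \<phi> p * map_poly \<phi> q"
  by (intro poly_eqI)
    (simp add: coeff_map_poly hom_on_zero coeff_mult hom_on_sum hom_on_mult polys_over_def mult_mem)

end

locale subfield_extension = subfield_minpoly F a m + field_hom_on F \<phi>
  for F :: "'a::field set" and a m and \<phi> :: "'a \<Rightarrow> 'b::field" +
  fixes b :: 'b
  assumes root_image: "poly (map_poly \<phi> m) b = 0"
begin

text \<open>The ring generated by \<open>a\<close> over \<open>F\<close>; by
  \<open>polys_over_inverse\<close> it is already the field generated by \<open>a\<close>.\<close>

definition adjoin :: "'a set" where
  "adjoin = (\<lambda>p. poly p a) ` polys_over F"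

definition extend :: "'a \<Rightarrow> 'b" where
  "extend x = poly (map_poly \<phi> (SOME p. p \<in> polys_over F \<and> poly p a = x)) b"

text \<open>The choice inside \<open>extend\<close> does not matter: two polynomials with the same
  value at \<open>a\<close> differ by a multiple of \<open>m\<close>, whose image vanishes at
  \<open>b\<close>.\<close>

lemma extend_poly:
  assumes "p \<in> polys_over F"
  shows "extend (poly p a) = poly (map_poly \<phi> p) b"
proof -
  define q where "q = (SOME q. q \<in> polys_over F \<and> poly q a = poly p a)"
  have q: "q \<in> polys_over F" "poly q a = poly p a"
    unfolding q_def using someI[of "\<lambda>q. q \<in> polys_over F \<and> poly q a = poly p a" p] assms by auto
  then obtain r where r: "r \<in> polys_over F" "q - p = r * m"
    using minpoly_dvd[of "q - p"] polys_over_diff assms by auto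
  have "poly (map_poly \<phi> (q - p)) b = 0"
    unfolding r(2) map_poly_mult_on[OF r(1) minpoly_over] using root_image by simp
  then show ?thesis
    using map_poly_diff_on[OF q(1) assms] by (simp add: extend_def q_def)
qed

lemma subset_adjoin: "F \<subseteq> adjoin"
proof
  fix c assume "c \<in> F"
  then show "c \<in> adjoin"
    unfolding adjoin_def using polys_over_const by (intro image_eqI[of _ _ "[:c:]"]) auto
qed

lemma extend_base: "c \<in> F \<Longrightarrow> extend c = \<phi> c"
  using extend_poly[OF polys_over_const, of c] by (cases "c = 0") (simp_all add: map_poly_pCons hom_on_zero)

lemma generator_poly: "[:0, 1:] \<in> polys_over F"
  using polys_over_pCons polys_over_const zero_mem one_mem by blast

lemma generator_mem: "a \<in> adjoin"
  unfolding adjoin_def using generator_poly by (intro image_eqI[of _ _ "[:0, 1:]"]) auto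

lemma extend_generator: "extend a = b"
  using extend_poly[OF generator_poly] by (simp add: map_poly_pCons hom_on_zero hom_on_one)

lemma field_hom_on_extend: "field_hom_on adjoin extend"
proof
  show "1 \<in> adjoin" using subset_adjoin one_mem by blast
  show "extend 1 = 1" using extend_base one_mem hom_on_one by simp
  fix x assume "x \<in> adjoin"
  then obtain p where p: "p \<in> polys_over F" "x = poly p a" unfolding adjoin_def by blast
  show "inverse x \<in> adjoin"
  proof (cases "x = 0")
    case True
    then show ?thesis using subset_adjoin zero_mem by auto
  next
    case False
    then obtain q where q: "q \<in> polys_over F" "poly p a * poly q a = 1"
      using polys_over_inverse p by blast
    then have "inverse x = poly q a" using p by (simp add: inverse_unique)
    then show ?thesis unfolding adjoin_def using q by blast
  qed
  fix y assume "y \<in> adjoin"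
  then obtain q where q: "q \<in> polys_over F" "y = poly q a" unfolding adjoin_def by blast
  show "x - y \<in> adjoin" "x * y \<in> adjoin"
    unfolding adjoin_def p(2) q(2) poly_diff[symmetric] poly_mult[symmetric]
    using p(1) q(1) polys_over_diff polys_over_mult by blast+
  show "extend (x + y) = extend x + extend y"
    using extend_poly[OF polys_over_add[OF p(1) q(1)]] map_poly_add_on[OF p(1) q(1)]
      extend_poly[OF p(1)] extend_poly[OF q(1)] by (simp add: p(2) q(2))
  show "extend (x * y) = extend x * extend y"
    using extend_poly[OF polys_over_mult[OF p(1) q(1)]] map_poly_mult_on[OF p(1) q(1)]
      extend_poly[OF p(1)] extend_poly[OF q(1)] by (simp add: p(2) q(2))
qed

end

lemma algebraic_minpoly:
  fixes F :: "'a::field_char_0 set"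
  assumes "subfield_set F" "algebraic a"
  shows "\<exists>m. subfield_minpoly F a m"
proof -
  interpret subfield_set F by fact
  obtain p where p: "\<forall>i. coeff p i \<in> \<int>" "p \<noteq> 0" "poly p a = 0"
    using assms(2) unfolding algebraic_def by blast
  have "coeff p i \<in> F" for i
  proof -
    have "coeff p i \<in> \<int>" using p(1) by simp
    then show ?thesis by (elim Ints_cases) (simp add: of_int_mem)
  qed
  then have "p \<in> polys_over F" by (simp add: polys_over_def)
  then show ?thesis using ex_minpoly p(2,3) by blast
qed

text \<open>The elements of \<open>A\<close> are adjoined one at a time. A minimal polynomial is
  monic, so it keeps its positive degree under the homomorphism; its image has a root in the
  algebraically closed target, and that root becomes the value at the new element.\<close>

lemma extend_field_hom_on:
  fixes \<phi> :: "'a::field_char_0 \<Rightarrow> 'b::alg_closed_field"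
  assumes "finite A" "\<And>a. a \<in> A \<Longrightarrow> algebraic a" "field_hom_on F \<phi>"
  shows "\<exists>F' \<phi>'. field_hom_on F' \<phi>' \<and> F \<subseteq> F' \<and> A \<subseteq> F' \<and> (\<forall>x\<in>F. \<phi>' x = \<phi> x)"
  using assms(1,2)
proof (induction A rule: finite_induct)
  case empty
  show ?case by (rule exI[of _ F], rule exI[of _ \<phi>]) (simp add: assms(3))
next
  case (insert a A)
  from insert.IH insert.prems
  obtain F1 \<phi>1 where IH: "field_hom_on F1 \<phi>1" "F \<subseteq> F1" "A \<subseteq> F1" "\<forall>x\<in>F. \<phi>1 x = \<phi> x"
    by blast
  interpret field_hom_on F1 \<phi>1 by fact
  obtain m where "subfield_minpoly F1 a m" using algebraic_minpoly subfield_set_axioms insert.prems by blast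
  then interpret subfield_minpoly F1 a m .
  have "degree (map_poly \<phi>1 m) = degree m"
    using minpoly_over hom_on_eq_0 minpoly_nonzero minpoly_monic hom_on_one
    by (intro map_poly_degree_eq) auto
  then obtain b where b: "poly (map_poly \<phi>1 m) b = 0"
    using degree_minpoly_pos alg_closed_imp_poly_has_root by metis
  interpret subfield_extension F1 a m \<phi>1 b by standard fact
  show ?case
    using field_hom_on_extend subset_adjoin extend_base generator_mem IH
    by (intro exI[of _ adjoin] exI[of _ extend]) auto
qed

lemma (in field_hom_on) hom_on_poly:
  assumes "p \<in> polys_over F" "a \<in> F"
  shows "\<phi> (poly p a) = poly (map_poly \<phi> p) (\<phi> a)"
proof -
  have "poly p a \<in> F \<and> \<phi> (poly p a) = poly (map_poly \<phi> p) (\<phi> a)"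
    using assms(1)
  proof (induction p)
    case 0
    show ?case by (simp add: zero_mem hom_on_zero)
  next
    case (pCons c p)
    have "c \<in> F" "p \<in> polys_over F"
      using pCons.prems by (auto simp: polys_over_def coeff_pCons split: nat.splits dest: spec[of _ 0] spec[of _ "Suc _"])
    with pCons show ?case
      using assms(2) by (auto simp: map_poly_pCons hom_on_zero hom_on_add hom_on_mult add_mem mult_mem)
  qed
  then show ?thesis ..
qed

section \<open>Minimal polynomials over the rationals\<close>

lemma subfield_set_Rats: "subfield_set (\<rat> :: 'a::field_char_0 set)"
  by standard auto

lemma polys_over_Rats_id:
  fixes p :: "'a::field_char_0 poly"
  assumes "p \<in> polys_over \<rat>" "\<forall>x\<in>\<rat>. \<tau> x = x"
  shows "map_poly \<tau> p = p"
  using assms by (intro poly_eqI) (auto simp: coeff_map_poly polys_over_def)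

text \<open>The identity of the rationals extends to \<open>z\<close> with value \<open>r\<close>,
  because \<open>r\<close> is a root of the minimal polynomial of \<open>z\<close>, and then further
  over \<open>A\<close>. Such a partial map plays the role of a Galois automorphism.\<close>

lemma conjugation_hom:
  fixes z r :: complex
  assumes "subfield_minpoly \<rat> z m" "poly m r = 0" "finite A" "\<And>a. a \<in> A \<Longrightarrow> algebraic a"
  obtains F \<tau> where "field_hom_on F \<tau>" "A \<subseteq> F" "z \<in> F" "\<rat> \<subseteq> F" "\<forall>x\<in>\<rat>. \<tau> x = x" "\<tau> z = r"
proof -
  interpret subfield_minpoly "\<rat>" z m by fact
  interpret subfield_extension "\<rat>" z m "\<lambda>x. x" r
    by standard (simp_all add: assms(2))
  obtain F \<tau> where \<tau>: "field_hom_on F \<tau>" "adjoin \<subseteq> F" "A \<subseteq> F" "\<forall>x\<in>adjoin. \<tau> x = extend x"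
    using extend_field_hom_on[OF assms(3,4) field_hom_on_extend] by blast
  show thesis
  proof (rule that[OF \<tau>(1,3)])
    show "z \<in> F" "\<rat> \<subseteq> F" using \<tau>(2) generator_mem subset_adjoin by blast+
    show "\<forall>x\<in>\<rat>. \<tau> x = x" using \<tau>(4) subset_adjoin extend_base by (metis subsetD)
    show "\<tau> z = r" using \<tau>(4) generator_mem extend_generator by metis
  qed
qed

text \<open>A homomorphism that sends \<open>z\<close> to \<open>r\<close> fixes rational
  coefficients and is injective, so a rational polynomial vanishing at \<open>r\<close> vanishes at
  \<open>z\<close> too.\<close>

lemma subfield_minpoly_conjugate:
  fixes z r :: complex
  assumes "subfield_minpoly \<rat> z m" "poly m r = 0"
  shows "subfield_minpoly \<rat> r m"
proof -
  interpret subfield_minpoly "\<rat>" z m by fact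
  obtain F \<tau> where \<tau>: "field_hom_on F \<tau>" "z \<in> F" "\<rat> \<subseteq> F" "\<forall>x\<in>\<rat>. \<tau> x = x" "\<tau> z = r"
    using conjugation_hom[OF assms, of "{}"] by auto
  interpret \<tau>: field_hom_on F \<tau> by fact
  show ?thesis
  proof
    show "degree m \<le> degree p" if p: "p \<in> polys_over \<rat>" "poly p r = 0" "p \<noteq> 0" for p
    proof -
      have pF: "p \<in> polys_over F" using p(1) \<tau>(3) by (auto simp: polys_over_def)
      have "\<tau> (poly p z) = 0"
        using \<tau>.hom_on_poly[OF pF \<tau>(2)] polys_over_Rats_id[OF p(1) \<tau>(4)] p(2) \<tau>(5) by simp
      moreover have "poly p z \<in> F"
        unfolding poly_altdef using pF \<tau>(2)
        by (intro \<tau>.sum_mem \<tau>.mult_mem) (auto simp: polys_over_def intro: \<tau>.power_mem)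
      ultimately show ?thesis using \<tau>.hom_on_eq_0 minpoly_min p by blast
    qed
  qed (use minpoly_over minpoly_monic assms(2) in auto)
qed

text \<open>\<open>m\<close> is minimal for each of its roots, so a multiple root would be a root of
  the nonzero polynomial \<open>pderiv m\<close>, whose degree is smaller.\<close>

lemma rsquarefree_minpoly:
  assumes "subfield_minpoly \<rat> (z::complex) m"
  shows "rsquarefree m"
  unfolding rsquarefree_roots
proof safe
  interpret m: subfield_minpoly "\<rat>" z m by fact
  fix r assume r: "poly m r = 0" "poly (pderiv m) r = 0"
  interpret subfield_minpoly "\<rat>" r m using subfield_minpoly_conjugate assms r(1) .
  have "pderiv m \<noteq> 0" using degree_minpoly_pos by (simp add: pderiv_eq_0_iff)
  then have "degree m \<le> degree (pderiv m)"
    using minpoly_min[OF m.polys_over_pderiv[OF minpoly_over]] r(2) by blast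
  then show False using degree_minpoly_pos by (simp add: degree_pderiv)
qed

text \<open>Gauss's lemma. A monic integer polynomial has content 1, so it is the product of the
  normalized integer polynomials belonging to \<open>g\<close> and \<open>h\<close>. Their leading
  coefficients are then 1 or -1, which forces the positive factor \<open>r\<close> between
  \<open>g\<close> and \<open>q\<close> to be 1.\<close>

lemma monic_rat_factor_int:
  fixes p :: "int poly"
  assumes "lead_coeff p = 1" "map_poly rat_of_int p = g * h" "lead_coeff g = 1"
  shows "\<exists>q. g = map_poly rat_of_int q"
proof -
  obtain r q where g: "rat_to_normalized_int_poly g = (r, q)" by fastforce
  obtain s w where h: "rat_to_normalized_int_poly h = (s, w)" by fastforce
  note g' = rat_to_normalized_int_poly[OF g]
  have "content p dvd 1" using content_dvd_coeff[of p "degree p"] assms(1) by simp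
  then have cp: "content p = 1" by (metis abs_content_int zdvd1_eq)
  have p0: "p \<noteq> 0" using assms(1) by auto
  have "p = q * w" by (rule rat_to_int_factor_content_1[OF cp assms(2) g h p0])
  then have "lead_coeff q * lead_coeff w = 1" using assms(1) by (simp add: lead_coeff_mult)
  then have "lead_coeff q = 1 \<or> lead_coeff q = -1" using zmult_eq_1_iff by blast
  moreover have "r * rat_of_int (lead_coeff q) = 1"
    using assms(3) g'(4) unfolding g'(1) by simp
  ultimately have "r = 1" using g'(2) by auto
  then show ?thesis using g'(1) by auto
qed

lemma ex_map_poly:
  assumes "inj h" "h 0 = 0" "\<And>i. coeff p i \<in> range h"
  shows "\<exists>q. p = map_poly h q"
proof
  have "inv_into UNIV h 0 = 0" using inv_f_f[OF assms(1), of 0] assms(2) by simp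
  then show "p = map_poly h (map_poly (inv_into UNIV h) p)"
    using assms(2,3) by (intro poly_eqI) (simp add: coeff_map_poly f_inv_into_f)
qed

lemma ex_map_poly_of_rat:
  fixes p :: "'a::field_char_0 poly"
  assumes "p \<in> polys_over \<rat>"
  shows "\<exists>q. p = map_poly of_rat q"
  by (rule ex_map_poly) (use assms in \<open>auto simp: inj_def polys_over_def Rats_def\<close>)

text \<open>A monic integer polynomial with root \<open>z\<close> is a multiple of \<open>m\<close>
  over the rationals. Both are pulled back along \<open>of_rat\<close> to rational polynomials,
  where Gauss's lemma applies.\<close>

lemma minpoly_algebraic_int:
  assumes "subfield_minpoly \<rat> (z :: 'a::field_char_0) m" "algebraic_int z"
  shows "coeff m i \<in> \<int>"
proof -
  interpret subfield_minpoly "\<rat>" z m by fact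
  obtain p where p: "lead_coeff p = 1" "\<forall>i. coeff p i \<in> \<int>" "poly p z = 0"
    using assms(2) by (auto simp: algebraic_int.simps)
  then have "p \<in> polys_over \<rat>" using Ints_subset_Rats by (auto simp: polys_over_def)
  then obtain q where q: "q \<in> polys_over \<rat>" "p = q * m" using minpoly_dvd p by blast
  interpret R: map_poly_inj_comm_ring_hom "of_rat :: rat \<Rightarrow> 'a" ..
  obtain q' where q': "q = map_poly of_rat q'" using ex_map_poly_of_rat[OF q(1)] ..
  obtain m' where m': "m = map_poly of_rat m'" using ex_map_poly_of_rat[OF minpoly_over] ..
  obtain P where P: "p = of_int_poly P"
    using ex_map_poly[of "of_int :: int \<Rightarrow> 'a" p] p(2) by (auto simp: inj_def Ints_def)
  have "map_poly (of_rat :: rat \<Rightarrow> 'a) (map_poly rat_of_int P) = map_poly of_rat (m' * q')"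
    using q(2) by (simp add: P q' m' map_poly_map_poly comp_def mult.commute hom_distribs)
  then have "map_poly rat_of_int P = m' * q'" by simp
  moreover have "lead_coeff P = 1" using p(1) by (simp add: P)
  moreover have "lead_coeff m' = 1" using minpoly_monic by (simp add: m')
  ultimately obtain M where "m' = map_poly rat_of_int M" using monic_rat_factor_int by blast
  then show ?thesis by (simp add: m' coeff_map_poly)
qed

section \<open>Complex embeddings of a number field\<close>

lemma vector_space_rat: "vector_space (\<lambda>(q::rat) x::'a::field_char_0. of_rat q * x)"
  by standard (simp_all add: algebra_simps of_rat_add of_rat_mult)

text \<open>More powers of \<open>x\<close> than there are generators are linearly dependent over
  the rationals, and a dependency is a rational polynomial with root \<open>x\<close>.\<close>

lemma finite_span_imp_algebraic:
  fixes B :: "'a::field_char_0 set"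
  assumes "finite B" "Modules.module.span (\<lambda>(q::rat) x. of_rat q * x) B = UNIV"
  shows "algebraic (x :: 'a)"
proof -
  interpret V: vector_space "\<lambda>(q::rat) x::'a. of_rat q * x" by (rule vector_space_rat)
  define n where "n = card B"
  define S where "S = (\<lambda>i. x ^ i) ` {..n}"
  show ?thesis
  proof (cases "inj_on (\<lambda>i. x ^ i) {..n}")
    \<comment> \<open>Equal powers would collapse in the set \<open>S\<close>, so this case is
      treated apart, by the difference of two monomials.\<close>
    case False
    then obtain i j where ij: "i \<noteq> j" "x ^ i = x ^ j" by (auto simp: inj_on_def)
    have "coeff (monom 1 i - monom (1::'a) j) k \<in> \<rat>" for k by auto
    moreover have "coeff (monom 1 i - monom (1::'a) j) i \<noteq> 0" using ij by simp
    then have "monom 1 i - monom (1::'a) j \<noteq> 0" by (metis coeff_0)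
    moreover have "poly (monom 1 i - monom 1 j) x = 0" using ij by (simp add: poly_monom)
    ultimately show ?thesis unfolding algebraic_altdef by blast
  next
    case True
    have "card S = Suc n" unfolding S_def using True by (simp add: card_image)
    then have "V.dependent S"
      using V.independent_span_bound[OF assms(1), of S] assms(2) by (auto simp: n_def)
    moreover have "finite S" by (simp add: S_def)
    ultimately obtain u where u: "\<exists>v\<in>S. u v \<noteq> 0" "(\<Sum>v\<in>S. of_rat (u v) * v) = 0"
      using V.dependent_finite by auto
    define p where "p = (\<Sum>i\<le>n. monom (of_rat (u (x ^ i)) :: 'a) i)"
    have cf: "coeff p k = (if k \<le> n then of_rat (u (x ^ k)) else 0)" for k
      by (simp add: p_def coeff_sum)
    obtain k where "k \<le> n" "u (x ^ k) \<noteq> 0" using u(1) by (auto simp: S_def)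
    then have "coeff p k \<noteq> 0" by (simp add: cf)
    then have "p \<noteq> 0" by (metis coeff_0)
    moreover have "coeff p k \<in> \<rat>" for k by (simp add: cf)
    moreover have "poly p x = 0"
      using u(2) True by (simp add: p_def poly_sum poly_monom S_def sum.reindex)
    ultimately show ?thesis unfolding algebraic_altdef by blast
  qed
qed

lemma (in field_hom) hom_of_int_eq: "hom (of_int k) = of_int k"
  by (cases k rule: int_cases2) (simp_all add: hom_distribs)

lemma field_hom_of_rat:
  fixes f :: "'a::field_char_0 \<Rightarrow> 'b::field_char_0"
  assumes "field_hom f"
  shows "f (of_rat q) = of_rat q"
proof -
  interpret field_hom f by fact
  show ?thesis
    by (cases q) (simp add: of_rat_rat hom_distribs hom_of_int_eq)
qed

lemma field_hom_map_poly_of_int: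
  fixes f :: "'a::field_char_0 \<Rightarrow> 'b::field_char_0"
  assumes "field_hom f" "\<forall>i. coeff p i \<in> \<int>"
  shows "\<forall>i. coeff (map_poly f p) i \<in> \<int>"
proof
  fix i
  interpret field_hom f by fact
  have "coeff p i \<in> \<int>" using assms(2) by simp
  then show "coeff (map_poly f p) i \<in> \<int>"
    by (elim Ints_cases) (simp add: hom_of_int_eq)
qed

lemma algebraic_field_hom:
  fixes f :: "'a::field_char_0 \<Rightarrow> 'b::field_char_0"
  assumes "field_hom f" "algebraic x"
  shows "algebraic (f x)"
proof -
  interpret field_hom f by fact
  interpret inj: map_poly_inj_idom_hom f ..
  obtain p where "\<forall>i. coeff p i \<in> \<int>" "p \<noteq> 0" "poly p x = 0"
    using assms(2) unfolding algebraic_def by blast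
  then have "\<forall>i. coeff (map_poly f p) i \<in> \<int>" "map_poly f p \<noteq> 0" "poly (map_poly f p) (f x) = 0"
    using field_hom_map_poly_of_int[OF assms(1)] by auto
  then show ?thesis unfolding algebraic_def by blast
qed

lemma algebraic_int_field_hom:
  fixes f :: "'a::field_char_0 \<Rightarrow> 'b::field_char_0"
  assumes "field_hom f" "algebraic_int x"
  shows "algebraic_int (f x)"
proof -
  interpret field_hom f by fact
  interpret inj: map_poly_inj_idom_hom f ..
  obtain p where "lead_coeff p = 1" "\<forall>i. coeff p i \<in> \<int>" "poly p x = 0"
    using assms(2) by (auto simp: algebraic_int.simps)
  then have "lead_coeff (map_poly f p) = 1" "\<forall>i. coeff (map_poly f p) i \<in> \<int>"
     "poly (map_poly f p) (f x) = 0"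
    using field_hom_map_poly_of_int[OF assms(1)] by auto
  then show ?thesis by (rule algebraic_int.intros)
qed

lemma inj_field_hom:
  assumes "field_hom f"
  shows "inj f"
proof -
  interpret field_hom f by fact
  interpret inj: map_poly_inj_idom_hom f ..
  show ?thesis by (simp add: inj_def)
qed

definition embeddings :: "('a::field_char_0 \<Rightarrow> complex) set" where
  "embeddings = {f. field_hom f}"

text \<open>Finiteness of the set of embeddings is an assumption here; in the theorem it comes from
  the labelling by \<open>{1..s+2*t}\<close>.\<close>

locale embedded_number_field =
  fixes B :: "'a::field_char_0 set"
  assumes finite_generators: "finite B"
    and span_generators: "Modules.module.span (\<lambda>(q::rat) x. of_rat q * x) B = UNIV"
    and finite_embeddings: "finite (embeddings :: ('a \<Rightarrow> complex) set)"
begin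

text \<open>A subfield contains the rationals, so the values on the generators decide. Hence
  homomorphisms only have to be extended over the finitely many images of generators.\<close>

lemma embedding_mem:
  assumes "subfield_set F" "f \<in> embeddings" "f ` B \<subseteq> F" 
  shows "f (x :: 'a) \<in> F"
proof -
  interpret subfield_set F by fact
  interpret V: vector_space "\<lambda>(q::rat) x::'a. of_rat q * x" by (rule vector_space_rat)
  interpret field_hom f using assms(2) by (simp add: embeddings_def)
  have rat: "f (of_rat q) \<in> F" for q
    by (cases q) (simp add: of_rat_rat hom_distribs hom_of_int_eq divide_mem of_int_mem)
  have "x \<in> V.span B" using span_generators by simp
  then show ?thesis
    by (induction rule: V.span_induct_alt)
      (use assms(3) rat in \<open>auto simp: hom_distribs zero_mem intro!: add_mem mult_mem\<close>)
qed

lemma embedding_comp: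
  assumes "field_hom_on F \<tau>" "f \<in> embeddings" "f ` B \<subseteq> F"
  shows "(\<lambda>x::'a. \<tau> (f x)) \<in> embeddings"
proof -
  interpret field_hom_on F \<tau> by fact
  interpret field_hom f using assms(2) by (simp add: embeddings_def)
  have "f x \<in> F" for x using embedding_mem[OF subfield_set_axioms assms(2,3)] .
  then have "field_hom (\<lambda>x. \<tau> (f x))"
    by unfold_locales (simp_all add: hom_distribs hom_on_zero hom_on_one hom_on_add hom_on_mult)
  then show ?thesis by (simp add: embeddings_def)
qed

lemma inj_on_embedding_comp:
  assumes "field_hom_on F \<tau>" "\<And>f::'a \<Rightarrow> complex. f \<in> embeddings \<Longrightarrow> f ` B \<subseteq> F"
  shows "inj_on (\<lambda>f (x::'a). \<tau> (f x)) embeddings"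
proof (rule inj_onI)
  fix f g :: "'a \<Rightarrow> complex"
  assume fg: "f \<in> embeddings" "g \<in> embeddings" "(\<lambda>x. \<tau> (f x)) = (\<lambda>x. \<tau> (g x))"
  interpret field_hom_on F \<tau> by fact
  show "f = g"
  proof
    fix x
    have mem: "f x \<in> F" "g x \<in> F" using embedding_mem[OF subfield_set_axioms] fg assms(2) by auto
    then have "\<tau> (f x - g x) = \<tau> (f x) - \<tau> (g x)"
      using hom_on_add[OF mem(1) uminus_mem[OF mem(2)]] hom_on_uminus[OF mem(2)] by simp
    also have "\<dots> = 0" using fun_cong[OF fg(3), of x] by simp
    finally show "f x = g x" using hom_on_eq_0[OF diff_mem[OF mem]] by simp
  qed
qed

lemma algebraic_generators_image:
  assumes "a \<in> (\<Union>f\<in>embeddings. f ` B)"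
  shows "algebraic (a :: complex)"
  using assms finite_span_imp_algebraic[OF finite_generators span_generators] algebraic_field_hom
  by (auto simp: embeddings_def)

lemma finite_generators_image: "finite (\<Union>f\<in>embeddings. f ` B :: complex set)"
  using finite_embeddings finite_generators by blast

lemma embedding_conjugation:
  assumes "subfield_minpoly \<rat> z m" "poly m r = 0"
  obtains F \<tau> where "field_hom_on F \<tau>" "\<And>f. f \<in> embeddings \<Longrightarrow> f ` B \<subseteq> F" "\<tau> z = (r :: complex)"
proof (rule conjugation_hom[OF assms finite_generators_image algebraic_generators_image])
  fix F \<tau>
  assume \<tau>: "field_hom_on F \<tau>" "(\<Union>f\<in>embeddings. f ` B) \<subseteq> F" "\<tau> z = r"
  have "f ` B \<subseteq> F" if "f \<in> embeddings" for f using \<tau>(2) that by blast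
  then show thesis by (rule that[OF \<tau>(1) _ \<tau>(3)])
qed

text \<open>Composing \<open>f0\<close> with a homomorphism that sends \<open>f0 u\<close> to
  \<open>r\<close> gives an embedding with value \<open>r\<close> at \<open>u\<close>. Conversely,
  \<open>m\<close> is the image under every embedding of one polynomial with rational coefficients,
  which vanishes at \<open>u\<close>.\<close>

lemma minpoly_roots:
  fixes u :: 'a
  assumes "f0 \<in> embeddings" "subfield_minpoly \<rat> (f0 u) m"
  shows "{r. poly m r = 0} = (\<lambda>f. f u) ` embeddings"
proof safe
  interpret subfield_minpoly "\<rat>" "f0 u" m by fact
  fix r assume "poly m r = 0"
  from embedding_conjugation[OF assms(2) this]
  obtain F \<tau> where \<tau>: "field_hom_on F \<tau>" "\<And>f. f \<in> embeddings \<Longrightarrow> f ` B \<subseteq> F" "\<tau> (f0 u) = r"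
    by blast
  have "(\<lambda>x. \<tau> (f0 x)) \<in> embeddings" using embedding_comp[OF \<tau>(1) assms(1) \<tau>(2)[OF assms(1)]] .
  then show "r \<in> (\<lambda>f. f u) ` embeddings"
    using \<tau>(3) by (intro image_eqI[of _ _ "\<lambda>x. \<tau> (f0 x)"]) simp_all
next
  interpret subfield_minpoly "\<rat>" "f0 u" m by fact
  fix f :: "'a \<Rightarrow> complex" assume f: "f \<in> embeddings"
  obtain m' where m': "m = map_poly of_rat m'" using ex_map_poly_of_rat[OF minpoly_over] ..
  have *: "poly m (g u) = g (poly (map_poly of_rat m') u)" if "g \<in> embeddings" for g
  proof -
    interpret field_hom g using that by (simp add: embeddings_def)
    interpret inj: map_poly_inj_idom_hom g ..
    have "m = map_poly g (map_poly of_rat m')"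
      using that by (intro poly_eqI) (simp add: m' field_hom_of_rat embeddings_def)
    then show ?thesis by simp
  qed
  have "poly (map_poly of_rat m') u = 0"
    using *[OF assms(1)] minpoly_root inj_field_hom[of f0] assms(1)
    by (simp add: embeddings_def) (metis field_hom_of_rat injD of_rat_0)
  then show "poly m (f u) = 0"
    using *[OF f] f field_hom_of_rat[of f 0] by (simp add: embeddings_def)
qed

text \<open>Composition with a homomorphism that sends \<open>f u\<close> to \<open>g u\<close> maps
  one fibre injectively into the other. By symmetry all fibres of evaluation at \<open>u\<close>
  have the same size, which replaces a count by the degree over the field generated by
  \<open>u\<close>.\<close>

lemma card_fibre_le:
  assumes "f \<in> embeddings" "g \<in> embeddings"
  shows "card {h \<in> embeddings. h u = f u} \<le> card {h \<in> embeddings. h (u::'a) = g u}"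
proof -
  have "algebraic (f u)"
    using assms(1) finite_span_imp_algebraic[OF finite_generators span_generators] algebraic_field_hom
    by (auto simp: embeddings_def)
  then obtain m where m: "subfield_minpoly \<rat> (f u) m"
    using algebraic_minpoly subfield_set_Rats by blast
  have "poly m (g u) = 0" using minpoly_roots[OF assms(1) m] assms(2) by blast
  from embedding_conjugation[OF m this]
  obtain F \<tau> where \<tau>: "field_hom_on F \<tau>" "\<And>f. f \<in> embeddings \<Longrightarrow> f ` B \<subseteq> F" "\<tau> (f u) = g u"
    by blast
  have inj: "inj_on (\<lambda>f (x::'a). \<tau> (f x)) embeddings"
    using inj_on_embedding_comp[OF \<tau>(1,2)] .
  show ?thesis
  proof (rule card_inj_on_le)
    show "inj_on (\<lambda>f (x::'a). \<tau> (f x)) {h \<in> embeddings. h u = f u}"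
      using inj by (rule inj_on_subset) auto
    show "(\<lambda>f x. \<tau> (f x)) ` {h \<in> embeddings. h u = f u} \<subseteq> {h \<in> embeddings. h u = g u}"
      using embedding_comp[OF \<tau>(1)] \<tau>(2,3) by auto
    show "finite {h \<in> embeddings. h u = g u}" using finite_embeddings by simp
  qed
qed

text \<open>A substitute for the transitive Galois action on a normal closure. The map
  \<open>g\<close> after the inverse of \<open>f\<close> is a homomorphism on
  \<open>range f\<close>; extended over the images of the generators, it acts on the embeddings by
  composition, injectively and, as they are finitely many, bijectively. Since only the permutation
  is returned, the multiplicative relation used later is transported here.\<close>

lemma transitive_on_embeddings:
  assumes "f \<in> embeddings" "g \<in> embeddings"
  obtains \<pi> where "bij_betw \<pi> embeddings embeddings" "\<pi> f = g"
    "\<And>h1 h2 h3 h4 u. {h1, h2, h3, h4} \<subseteq> embeddings \<Longrightarrow> h1 u * h2 u = h3 u * h4 u \<Longrightarrow>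
       \<pi> h1 (u::'a) * \<pi> h2 u = \<pi> h3 u * \<pi> h4 u"
proof -
  interpret f: field_hom f using assms(1) by (simp add: embeddings_def)
  interpret g: field_hom g using assms(2) by (simp add: embeddings_def)
  have injf: "inj f" using inj_field_hom f.field_hom_axioms .
  have [simp]: "inv_into UNIV f (f x) = x" for x using injf by (rule inv_f_f)
  have "field_hom_on (range f) (\<lambda>y. g (inv_into UNIV f y))"
  proof
    show "1 \<in> range f" by (rule image_eqI[of _ _ 1]) (simp_all)
    show "x - y \<in> range f" "x * y \<in> range f" if "x \<in> range f" "y \<in> range f" for x y
      using that by (auto simp flip: f.hom_minus f.hom_mult)
    show "inverse x \<in> range f" if "x \<in> range f" for x
      using that by (auto simp flip: f.hom_inverse)
    have "inv_into UNIV f 1 = 1" using \<open>inv_into UNIV f (f 1) = 1\<close> by simp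
    then show "g (inv_into UNIV f 1) = 1" by simp
    show "g (inv_into UNIV f (x + y)) = g (inv_into UNIV f x) + g (inv_into UNIV f y)"
      "g (inv_into UNIV f (x * y)) = g (inv_into UNIV f x) * g (inv_into UNIV f y)"
      if "x \<in> range f" "y \<in> range f" for x y
      using that by (auto simp: g.hom_add g.hom_mult simp flip: f.hom_add f.hom_mult)
  qed
  from extend_field_hom_on[OF _ algebraic_generators_image this, of "\<Union>f\<in>embeddings. f ` B"]
  obtain F \<tau> where \<tau>: "field_hom_on F \<tau>" "(\<Union>f\<in>embeddings. f ` B) \<subseteq> F" "\<And>x. \<tau> (f x) = g x"
    using finite_generators_image by auto
  interpret field_hom_on F \<tau> by fact
  have mem: "h u \<in> F" if "h \<in> embeddings" for h and u :: 'a
    using embedding_mem[OF subfield_set_axioms that] that \<tau>(2) by blast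
  define \<pi> where "\<pi> = (\<lambda>f (x::'a). \<tau> (f x))"
  show thesis
  proof (rule that[of \<pi>])
    have inj: "inj_on \<pi> embeddings" unfolding \<pi>_def
      using inj_on_embedding_comp[OF \<tau>(1)] \<tau>(2) by blast
    moreover have "\<pi> ` embeddings \<subseteq> embeddings"
      unfolding \<pi>_def using embedding_comp[OF \<tau>(1)] \<tau>(2) by blast
    ultimately show "bij_betw \<pi> embeddings embeddings"
      using endo_inj_surj[OF finite_embeddings] by (simp add: bij_betw_def)
    show "\<pi> f = g" by (simp add: \<pi>_def \<tau>(3))
    show "\<pi> h1 u * \<pi> h2 u = \<pi> h3 u * \<pi> h4 u"
      if "{h1, h2, h3, h4} \<subseteq> embeddings" "h1 u * h2 u = h3 u * h4 u" for h1 h2 h3 h4 u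
      using that mem by (simp add: \<pi>_def flip: hom_on_mult)
  qed
qed

text \<open>The product over the distinct values at \<open>u\<close> is the absolute value of the
  constant term of \<open>m\<close>, a nonzero integer. The product over all embeddings is a power
  of it, because all fibres have the same size.\<close>

lemma one_le_prod_embeddings:
  assumes "algebraic_int (u::'a)" "u \<noteq> 0"
  shows "1 \<le> (\<Prod>f\<in>embeddings. cmod (f u))"
proof (cases "(embeddings :: ('a \<Rightarrow> complex) set) = {}")
  case True
  then show ?thesis by simp
next
  case False
  then obtain f0 :: "'a \<Rightarrow> complex" where f0: "f0 \<in> embeddings" by blast
  have f0u: "algebraic_int (f0 u)"
    using f0 assms(1) algebraic_int_field_hom by (auto simp: embeddings_def)
  then obtain m where m: "subfield_minpoly \<rat> (f0 u) m"
    using algebraic_minpoly subfield_set_Rats by blast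
  interpret subfield_minpoly "\<rat>" "f0 u" m by fact
  define R where "R = (\<lambda>f. f u) ` (embeddings :: ('a \<Rightarrow> complex) set)"
  have R: "{r. poly m r = 0} = R" unfolding R_def by (rule minpoly_roots[OF f0 m])
  have finR: "finite R" by (simp add: R_def finite_embeddings)
  \<comment> \<open>The roots of \<open>m\<close> are simple, so the product over the set
    \<open>R\<close> carries no multiplicities.\<close>
  have "m = (\<Prod>z\<in>R. [:-z, 1:])"
    using complex_poly_decompose_rsquarefree[OF rsquarefree_minpoly[OF m]] minpoly_monic R by simp
  then have "coeff m 0 = (\<Prod>z\<in>R. - z)"
    by (simp add: poly_prod flip: poly_0_coeff_0)
  then have "cmod (coeff m 0) = (\<Prod>z\<in>R. cmod z)" by (simp flip: prod_norm)
  moreover have "f u \<noteq> 0" if "f \<in> embeddings" for f :: "'a \<Rightarrow> complex"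
    using that assms(2) inj_field_hom[of f] field_hom_of_rat[of f 0]
    by (auto simp: embeddings_def dest: injD[of f u 0])
  then have "(\<Prod>z\<in>R. cmod z) \<noteq> 0" using finR by (auto simp: R_def)
  moreover obtain k where "coeff m 0 = of_int k"
    using minpoly_algebraic_int[OF m f0u, of 0] by (elim Ints_cases)
  ultimately have "(\<Prod>z\<in>R. cmod z) = \<bar>real_of_int k\<bar>" "k \<noteq> 0" by auto
  then have R1: "1 \<le> (\<Prod>z\<in>R. cmod z)" by linarith
  define n where "n = card {h \<in> embeddings. h u = f0 u}"
  have n: "card {f \<in> embeddings. f u = z} = n" if "z \<in> R" for z
    using that card_fibre_le f0 by (auto simp: R_def n_def intro!: antisym)
  have "(\<Prod>f\<in>embeddings. cmod (f u)) = (\<Prod>z\<in>R. \<Prod>f\<in>{f \<in> embeddings. f u = z}. cmod (f u))"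
    using finR by (intro prod.group[symmetric] finite_embeddings) (auto simp: R_def)
  also have "\<dots> = (\<Prod>z\<in>R. cmod z ^ n)"
    by (intro prod.cong refl) (simp add: n flip: n)
  also have "\<dots> = (\<Prod>z\<in>R. cmod z) ^ n" by (simp add: prod_power_distrib)
  finally show ?thesis using R1 by simp
qed

text \<open>The lower bound 1 holds for \<open>u\<close> and for its inverse, and the two products
  are reciprocal.\<close>

lemma prod_embeddings_unit:
  assumes "algebraic_int (u::'a)" "algebraic_int (inverse u)" "u \<noteq> 0"
  shows "(\<Prod>f\<in>embeddings. cmod (f u)) = 1"
proof -
  have "cmod (f (inverse u)) = inverse (cmod (f u))" if "f \<in> embeddings" for f :: "'a \<Rightarrow> complex"
  proof -
    interpret field_hom f using that by (simp add: embeddings_def)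
    show ?thesis by (simp add: hom_inverse norm_inverse)
  qed
  then have "(\<Prod>f\<in>embeddings. cmod (f (inverse u))) = inverse (\<Prod>f\<in>embeddings. cmod (f u))"
    by (simp add: prod_inversef[unfolded comp_def])
  moreover have "1 \<le> (\<Prod>f\<in>embeddings. cmod (f (inverse u)))" "1 \<le> (\<Prod>f\<in>embeddings. cmod (f u))"
    using one_le_prod_embeddings assms by auto
  ultimately show ?thesis
    by (metis inverse_inverse_eq one_le_inverse_iff antisym)
qed

end

section \<open>Algebraic integers with bounded conjugates\<close>

lemma norm_coeff_prod_linear_le:
  fixes R :: "'a::real_normed_field set"
  assumes "finite R" "\<And>z. z \<in> R \<Longrightarrow> norm z \<le> M" "M \<ge> 0"
  shows "norm (coeff (\<Prod>z\<in>R. [:-z, 1:]) i) \<le> (1 + M) ^ card R"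
  using assms(1,2)
proof (induction R arbitrary: i rule: finite_induct)
  case empty
  then show ?case by simp
next
  case (insert z R)
  let ?p = "\<Prod>z\<in>R. [:-z, 1:]"
  have IH: "norm (coeff ?p j) \<le> (1 + M) ^ card R" for j using insert by auto
  have 1: "norm (z * coeff ?p i) \<le> M * (1 + M) ^ card R"
    unfolding norm_mult using IH[of i] insert.prems[of z] assms(3) by (intro mult_mono) auto
  have 2: "norm (coeff (pCons 0 ?p) i) \<le> (1 + M) ^ card R"
    using IH[of "i - 1"] assms(3) by (cases i) auto
  \<comment> \<open>Multiplication by \<open>[:-z, 1:]\<close> shifts the coefficients and subtracts
    \<open>z\<close> times them, so each linear factor enlarges the bound by at most
    \<open>1 + M\<close>.\<close>
  have "norm (coeff ([:-z, 1:] * ?p) i) = norm (coeff (pCons 0 ?p) i - z * coeff ?p i)"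
    by (simp add: algebra_simps)
  also have "\<dots> \<le> (1 + M) ^ card R + M * (1 + M) ^ card R"
    using norm_triangle_ineq4 1 2 by (smt (verit))
  also have "\<dots> = (1 + M) ^ card (insert z R)"
    using insert.hyps by (simp add: algebra_simps)
  finally show ?case using insert.hyps by simp
qed

text \<open>Such a polynomial is given by its coefficient list, of length at most
  \<open>Suc n\<close> over a finite set of integers.\<close>

lemma finite_bounded_int_polys:
  "finite {p :: complex poly. degree p \<le> n \<and> (\<forall>i. coeff p i \<in> \<int> \<and> cmod (coeff p i) \<le> C)}"
proof (rule finite_subset)
  let ?T = "(of_int :: int \<Rightarrow> complex) ` {-\<lceil>C\<rceil>..\<lceil>C\<rceil>}"
  show "finite (Poly ` {xs. set xs \<subseteq> ?T \<and> length xs \<le> Suc n})"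
    by (intro finite_imageI finite_lists_length_le) auto
  show "{p. degree p \<le> n \<and> (\<forall>i. coeff p i \<in> \<int> \<and> cmod (coeff p i) \<le> C)}
      \<subseteq> Poly ` {xs. set xs \<subseteq> ?T \<and> length xs \<le> Suc n}"
  proof safe
    fix p :: "complex poly"
    assume p: "degree p \<le> n" "\<forall>i. coeff p i \<in> \<int> \<and> cmod (coeff p i) \<le> C"
    have "x \<in> ?T" if "x \<in> set (coeffs p)" for x
    proof -
      have "x \<in> range (coeff p)" using that by (simp add: range_coeff)
      then obtain i where i: "x = coeff p i" ..
      then obtain k where k: "x = of_int k" using p(2) Ints_cases by metis
      have "cmod (coeff p i) \<le> C" using p(2) by simp
      then have "\<bar>of_int k\<bar> \<le> C" using k i by simp
      then have "k \<in> {-\<lceil>C\<rceil>..\<lceil>C\<rceil>}" by (simp, linarith)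
      then show ?thesis using k by blast
    qed
    moreover have "length (coeffs p) \<le> Suc n"
      using p(1) by (cases "p = 0") (simp_all add: length_coeffs_degree)
    ultimately show "p \<in> Poly ` {xs. set xs \<subseteq> ?T \<and> length xs \<le> Suc n}"
      by (intro image_eqI[of _ _ "coeffs p"]) (simp, blast)
  qed
qed

context embedded_number_field
begin

text \<open>Bounded conjugates bound the integer coefficients of the minimal polynomial, and its
  degree is at most the number of embeddings. So \<open>f0 u\<close> is a root of one of finitely
  many polynomials, and \<open>f0\<close> is injective.\<close>

lemma finite_bounded_algebraic_ints:
  assumes "(embeddings :: ('a \<Rightarrow> complex) set) \<noteq> {}"
  shows "finite {u::'a. algebraic_int u \<and> (\<forall>f\<in>embeddings. cmod (f u) \<le> M)}"
proof -
  obtain f0 :: "'a \<Rightarrow> complex" where f0: "f0 \<in> embeddings" using assms by blast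
  define n where "n = card (embeddings :: ('a \<Rightarrow> complex) set)"
  define P where "P = {p. p \<noteq> 0 \<and> degree p \<le> n \<and> (\<forall>i. coeff p i \<in> \<int> \<and> cmod (coeff p i) \<le> (1 + M) ^ n)}"
  have "finite P"
    by (rule finite_subset[OF _ finite_bounded_int_polys[of n "(1 + M) ^ n"]]) (auto simp: P_def)
  moreover have "finite {z. poly p z = 0}" if "p \<in> P" for p
    using that poly_roots_finite by (auto simp: P_def)
  ultimately have fin: "finite (\<Union>p\<in>P. {z. poly p z = 0})" by blast
  have "f0 u \<in> (\<Union>p\<in>P. {z. poly p z = 0})"
    if u: "algebraic_int u" "\<forall>f\<in>embeddings. cmod (f u) \<le> M" for u
  proof -
    have f0u: "algebraic_int (f0 u)"
      using f0 u(1) algebraic_int_field_hom by (auto simp: embeddings_def)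
    then obtain m where m: "subfield_minpoly \<rat> (f0 u) m"
      using algebraic_minpoly subfield_set_Rats by blast
    interpret subfield_minpoly "\<rat>" "f0 u" m by fact
    define R where "R = (\<lambda>f. f u) ` (embeddings :: ('a \<Rightarrow> complex) set)"
    have R: "{r. poly m r = 0} = R" unfolding R_def by (rule minpoly_roots[OF f0 m])
    have finR: "finite R" "card R \<le> n" by (simp_all add: R_def finite_embeddings n_def card_image_le)
    have M: "M \<ge> 0" using u(2) f0 norm_ge_zero order_trans by blast
    have mR: "m = (\<Prod>z\<in>R. [:-z, 1:])"
      using complex_poly_decompose_rsquarefree[OF rsquarefree_minpoly[OF m]] minpoly_monic R by simp
    have "degree m = card R"
      unfolding mR by (subst degree_prod_eq_sum_degree) auto
    moreover have "cmod (coeff m i) \<le> (1 + M) ^ n" for i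
    proof -
      have "cmod (coeff m i) \<le> (1 + M) ^ card R"
        unfolding mR using finR(1) u(2) M by (intro norm_coeff_prod_linear_le) (auto simp: R_def)
      also have "\<dots> \<le> (1 + M) ^ n" using finR(2) M by (intro power_increasing) auto
      finally show ?thesis .
    qed
    ultimately have "m \<in> P"
      using minpoly_algebraic_int[OF m f0u] minpoly_nonzero finR(2) by (simp add: P_def)
    then show ?thesis using minpoly_root by blast
  qed
  then have "finite (f0 ` {u. algebraic_int u \<and> (\<forall>f\<in>embeddings. cmod (f u) \<le> M)})"
    by (intro finite_subset[OF _ fin]) blast
  moreover have "inj_on f0 {u. algebraic_int u \<and> (\<forall>f\<in>embeddings. cmod (f u) \<le> M)}"
    using inj_field_hom[of f0] f0 by (auto simp: embeddings_def intro: inj_on_subset)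
  ultimately show ?thesis by (rule finite_imageD)
qed

end

section \<open>Rank of groups with discrete logarithms\<close>

text \<open>Gaussian elimination on the points with coordinates \<open>a i u\<close>: a point
  \<open>w\<close> with nonzero coordinate \<open>i\<close> clears that coordinate, and induction
  treats the others.\<close>

lemma ex_spanning_points:
  fixes a :: "'i \<Rightarrow> 'u \<Rightarrow> real"
  assumes "finite I"
  shows "\<exists>V\<subseteq>U. finite V \<and> card V \<le> card I \<and>
           (\<forall>u\<in>U. \<exists>x. \<forall>i\<in>I. a i u = (\<Sum>v\<in>V. x v * a i v))"
  using assms
proof (induction I arbitrary: a rule: finite_induct)
  case empty
  show ?case by (intro exI[of _ "{}"]) simp
next
  case (insert i I)
  show ?case
  proof (cases "\<forall>u\<in>U. a i u = 0")
    case True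
    obtain V where V: "V \<subseteq> U" "finite V" "card V \<le> card I"
      "\<forall>u\<in>U. \<exists>x. \<forall>i\<in>I. a i u = (\<Sum>v\<in>V. x v * a i v)"
      using insert.IH[of a] by blast
    have "a i u = (\<Sum>v\<in>V. x v * a i v)" if "u \<in> U" for x u
      using V(1) True that by (simp add: subset_iff)
    then have "\<forall>u\<in>U. \<exists>x. \<forall>j\<in>insert i I. a j u = (\<Sum>v\<in>V. x v * a j v)"
      using V(4) by simp
    then show ?thesis using V(1-3) insert.hyps by (intro exI[of _ V]) simp
  next
    case False
    then obtain w where w: "w \<in> U" "a i w \<noteq> 0" by blast
    \<comment> \<open>\<open>b j\<close> is \<open>a j\<close> minus the multiple of
      \<open>a i\<close> that makes it vanish at \<open>w\<close>.\<close>
    define b where "b j u = a j u - a j w / a i w * a i u" for j u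
    obtain V where V: "V \<subseteq> U" "finite V" "card V \<le> card I"
      "\<forall>u\<in>U. \<exists>x. \<forall>j\<in>I. b j u = (\<Sum>v\<in>V. x v * b j v)"
      using insert.IH[of b] by blast
    have "\<exists>y. \<forall>j\<in>insert i I. a j u = (\<Sum>v\<in>insert w V. y v * a j v)" if "u \<in> U" for u
    proof -
      from bspec[OF V(4) that] obtain x where x: "\<forall>j\<in>I. b j u = (\<Sum>v\<in>V. x v * b j v)" ..
      \<comment> \<open>The coefficient of \<open>w\<close> is fixed by coordinate \<open>i\<close>;
        the other coordinates then agree by the choice of \<open>b\<close>.\<close>
      define c where "c = (a i u - (\<Sum>v\<in>V. x v * a i v)) / a i w"
      \<comment> \<open>\<open>w\<close> may already lie in \<open>V\<close>, so its two
        coefficients are added.\<close>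
      define y where "y v = (if v \<in> V then x v else 0) + (if v = w then c else 0)" for v
      have y: "(\<Sum>v\<in>insert w V. y v * a j v) = (\<Sum>v\<in>V. x v * a j v) + c * a j w" for j
      proof -
        have "(\<Sum>v\<in>insert w V. y v * a j v) =
          (\<Sum>v\<in>insert w V. if v \<in> V then x v * a j v else 0) +
          (\<Sum>v\<in>insert w V. if v = w then c * a j v else 0)"
          unfolding sum.distrib[symmetric]
          by (intro sum.cong refl) (simp add: y_def algebra_simps)
        also have "(\<Sum>v\<in>insert w V. if v = w then c * a j v else 0) = c * a j w"
          using V(2) by simp
        also have "(\<Sum>v\<in>insert w V. if v \<in> V then x v * a j v else 0) = (\<Sum>v\<in>V. x v * a j v)"
          using V(2) by (intro sum.mono_neutral_cong_right) auto
        finally show ?thesis .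
      qed
      have "a j u = (\<Sum>v\<in>insert w V. y v * a j v)" if "j \<in> insert i I" for j
      proof (cases "j = i")
        case True
        then show ?thesis using w(2) by (simp add: y c_def)
      next
        case False
        with that have "b j u = (\<Sum>v\<in>V. x v * b j v)" using x by simp
        also have "\<dots> = (\<Sum>v\<in>V. x v * a j v) - a j w / a i w * (\<Sum>v\<in>V. x v * a i v)"
          by (simp add: b_def algebra_simps sum_subtractf sum_distrib_left)
        finally show ?thesis unfolding y by (simp add: b_def c_def field_simps w(2))
      qed
      then show ?thesis by blast
    qed
    moreover have "card (insert w V) \<le> card (insert i I)"
      using V(2,3) insert.hyps by (simp add: card_insert_if)
    ultimately show ?thesis using V(1,2) w(1) by (intro exI[of _ "insert w V"]) blast
  qed
qed

section \<open>Real characters and groups generated up to torsion\<close>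

locale real_character = group G for G (structure) +
  fixes a :: "'a \<Rightarrow> real"
  assumes character_mult: "x \<in> carrier G \<Longrightarrow> y \<in> carrier G \<Longrightarrow> a (x \<otimes> y) = a x + a y"
begin

lemma character_one: "a \<one> = 0"
  using character_mult[OF one_closed one_closed] by simp

lemma character_inv: "x \<in> carrier G \<Longrightarrow> a (inv x) = - a x"
  using character_mult[of x "inv x"] character_one by simp

lemma character_pow: "x \<in> carrier G \<Longrightarrow> a (x [^] (n::nat)) = real n * a x"
  by (induction n) (simp_all add: character_one character_mult algebra_simps)

lemma character_int_pow: "x \<in> carrier G \<Longrightarrow> a (x [^] (k::int)) = real_of_int k * a x"
  by (cases k rule: int_cases2) (simp_all add: int_pow_int int_pow_neg character_pow character_inv)

end

text \<open>The witness is a product of the powers \<open>v [^] k v\<close>; real characters do not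
  see the order of its factors, and one witness serves all \<open>i\<close>.\<close>

lemma (in group) ex_generate_combination:
  assumes "finite V" "V \<subseteq> carrier G" "\<And>i. i \<in> I \<Longrightarrow> real_character G (a i)"
  shows "\<exists>h\<in>generate G V. \<forall>i\<in>I. a i h = (\<Sum>v\<in>V. real_of_int (k v) * a i v)"
  using assms(1,2)
proof (induction V rule: finite_induct)
  case empty
  show ?case
    using real_character.character_one[OF assms(3)] by (intro bexI[of _ \<one>]) (auto intro: generate.one)
next
  case (insert v V)
  then obtain h where h: "h \<in> generate G V" "\<forall>i\<in>I. a i h = (\<Sum>v\<in>V. real_of_int (k v) * a i v)"
    by blast
  have sub: "subgroup (generate G (insert v V)) G"
    using insert.prems by (rule generate_is_subgroup)
  have v: "v \<in> carrier G" using insert.prems by simp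
  have hc: "h \<in> carrier G" using h(1) insert.prems generate_in_carrier[of V] by blast
  have "h \<in> generate G (insert v V)" using h(1) mono_generate[of V "insert v V"] by blast
  moreover have "v [^] k v \<in> generate G (insert v V)"
    using subgroup_int_pow_closed[OF sub] by (simp add: generate.incl)
  ultimately have "v [^] k v \<otimes> h \<in> generate G (insert v V)" by (rule generate.eng[rotated])
  moreover have "a i (v [^] k v \<otimes> h) = (\<Sum>v\<in>insert v V. real_of_int (k v) * a i v)" if "i \<in> I" for i
  proof -
    interpret real_character G "a i" using assms(3)[OF that] .
    show ?thesis
      using h(2) that hc v insert.hyps by (simp add: character_mult character_int_pow)
  qed
  ultimately show ?case by blast
qed

text \<open>The powers of \<open>u\<close>, each divided by the combination of the \<open>v\<close> with the rounded down
  coefficients, stay in a bounded set, so two of them agree.\<close>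

lemma (in group) torsion_mod_generate_if_discrete:
  fixes a :: "'i \<Rightarrow> 'a \<Rightarrow> real"
  assumes "finite I" "\<And>i. i \<in> I \<Longrightarrow> real_character G (a i)"
    and discrete: "\<And>M. finite {u \<in> carrier G. \<forall>i\<in>I. \<bar>a i u\<bar> \<le> M}"
  shows "\<exists>V\<subseteq>carrier G. finite V \<and> card V \<le> card I \<and>
           (\<forall>u\<in>carrier G. \<exists>n>0. u [^] (n::nat) \<in> generate G V)"
proof -
  obtain V where V: "V \<subseteq> carrier G" "finite V" "card V \<le> card I"
    "\<forall>u\<in>carrier G. \<exists>x. \<forall>i\<in>I. a i u = (\<Sum>v\<in>V. x v * a i v)"
    using ex_spanning_points[OF assms(1), of "carrier G" a] by blast
  have sub: "subgroup (generate G V) G" using V(1) by (rule generate_is_subgroup)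
  have "\<exists>n>0. u [^] (n::nat) \<in> generate G V" if u: "u \<in> carrier G" for u
  proof -
    obtain x where x: "\<forall>i\<in>I. a i u = (\<Sum>v\<in>V. x v * a i v)" using V(4) u by blast
    have "\<exists>h. \<forall>n. h n \<in> generate G V \<and> (\<forall>i\<in>I. a i (h n) = (\<Sum>v\<in>V. real_of_int \<lfloor>real n * x v\<rfloor> * a i v))"
      using ex_generate_combination[OF V(2,1) assms(2), of I]
      by (intro choice) (simp add: Bex_def)
    then obtain h where h: "\<And>n. h n \<in> generate G V"
      "\<And>n i. i \<in> I \<Longrightarrow> a i (h n) = (\<Sum>v\<in>V. real_of_int \<lfloor>real n * x v\<rfloor> * a i v)" by blast
    have hc: "h n \<in> carrier G" for n using h(1) subgroup.subset[OF sub] by blast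
    define w where "w n = u [^] n \<otimes> inv (h n)" for n :: nat
    \<comment> \<open>Fractional parts lie between 0 and 1, so this bound does not depend on
      \<open>n\<close>.\<close>
    define M where "M = (\<Sum>i\<in>I. \<Sum>v\<in>V. \<bar>a i v\<bar>)"
    have "\<bar>a i (w n)\<bar> \<le> M" if i: "i \<in> I" for i n
    proof -
      interpret real_character G "a i" using assms(2)[OF i] .
      have "a i (w n) = real n * a i u - a i (h n)"
        using u hc by (simp add: w_def character_mult character_pow character_inv)
      also have "\<dots> = (\<Sum>v\<in>V. (real n * x v - real_of_int \<lfloor>real n * x v\<rfloor>) * a i v)"
        using x i by (simp add: h(2) sum_distrib_left algebra_simps sum_subtractf)
      also have "\<bar>\<dots>\<bar> \<le> (\<Sum>v\<in>V. \<bar>a i v\<bar>)"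
      proof (intro order_trans[OF sum_abs] sum_mono)
        fix v
        have "\<bar>real n * x v - real_of_int \<lfloor>real n * x v\<rfloor>\<bar> \<le> 1" by linarith
        then show "\<bar>(real n * x v - real_of_int \<lfloor>real n * x v\<rfloor>) * a i v\<bar> \<le> \<bar>a i v\<bar>"
          unfolding abs_mult by (simp add: mult_left_le_one_le)
      qed
      also have "\<dots> \<le> M"
        unfolding M_def using assms(1) i by (intro member_le_sum) (auto intro: sum_nonneg)
      finally show ?thesis .
    qed
    moreover have "w n \<in> carrier G" for n using u hc by (simp add: w_def)
    ultimately have "range w \<subseteq> {u \<in> carrier G. \<forall>i\<in>I. \<bar>a i u\<bar> \<le> M}" by blast
    then have "finite (range w)" using discrete finite_subset by blast
    then have "\<not> inj w" using finite_imageD infinite_UNIV_nat by blast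
    then obtain n m where nm: "n < m" "w n = w m"
      by (metis injI linorder_neq_iff)
    \<comment> \<open>Cancelling \<open>u [^] n\<close> in \<open>w n = w m\<close> expresses a
      positive power of \<open>u\<close> by \<open>h n\<close> and \<open>h m\<close>.\<close>
    have "u [^] n \<otimes> inv (h n) = u [^] n \<otimes> (u [^] (m - n) \<otimes> inv (h m))"
      using nm u hc by (simp add: w_def m_assoc[symmetric] nat_pow_mult)
    then have "inv (h n) = u [^] (m - n) \<otimes> inv (h m)" using u hc by simp
    then have "u [^] (m - n) = inv (h n) \<otimes> h m" using u hc by (simp add: m_assoc)
    also have "\<dots> \<in> generate G V"
      using sub h(1) by (simp add: subgroup.m_closed subgroup.m_inv_closed)
    finally show ?thesis using nm(1) by (intro exI[of _ "m - n"]) simp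
  qed
  then show ?thesis using V(1-3) by blast
qed

text \<open>The pure tensors of the elements of \<open>V\<close> with 1 span the tensor product: the
  tensor of \<open>u\<close> with \<open>q\<close> is \<open>q / n\<close> times that of
  \<open>u [^] n\<close> with 1, and \<open>u [^] n\<close> is a product of elements of
  \<open>V\<close> and their inverses.\<close>

lemma has_Z_rank_le:
  assumes "comm_group G" "has_Z_rank G r" "finite V" "V \<subseteq> carrier G"
    and power: "\<And>u. u \<in> carrier G \<Longrightarrow> \<exists>n>0. u [^]\<^bsub>G\<^esub> (n::nat) \<in> generate G V"
  shows "r \<le> card V"
proof -
  interpret G: comm_group G by fact
  have m: "monoid G" ..
  interpret V: vectorspace "class_ring :: rat ring" "tensor_rat G"
    by (rule vectorspace_tensor_rat[OF assms(1)])
  interpret F: comm_group "tensor_rat_free G" by (rule comm_group_tensor_rat_free)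
  define cl where "cl c = tensor_rat_kernel G #>\<^bsub>tensor_rat_free G\<^esub> c" for c
  define pure where "pure g q = cl (frag_of (g, q))" for g q
  have N: "tensor_rat_kernel G \<lhd> tensor_rat_free G"
    using subgroup_tensor_rat_kernel[OF m] F.normal_iff_subgroup by blast
  have car: "carrier (tensor_rat G) = cl ` carrier (tensor_rat_free G)"
    by (simp add: tensor_rat_def carrier_FactGroup cl_def)
  have add: "cl c \<oplus>\<^bsub>tensor_rat G\<^esub> cl d = cl (c + d)"
    if "c \<in> carrier (tensor_rat_free G)" "d \<in> carrier (tensor_rat_free G)" for c d
    using normal.rcos_sum[OF N that] by (simp add: cl_def tensor_rat_def tensor_rat_free_def)
  have scale: "q \<odot>\<^bsub>tensor_rat G\<^esub> cl c = cl (tensor_rat_scale q c)"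
    if "c \<in> carrier (tensor_rat_free G)" for q c
    using tensor_rat_smult_coset[OF m that] by (simp add: cl_def)
  have fr: "frag_of (g, q) \<in> carrier (tensor_rat_free G)" if "g \<in> carrier G" for g q
    using that by (simp add: tensor_rat_free_def)
  have pure_mem: "pure g q \<in> carrier (tensor_rat G)" if "g \<in> carrier G" for g q
    using fr that by (auto simp: pure_def car)
  have pure_scale: "p \<odot>\<^bsub>tensor_rat G\<^esub> pure g q = pure g (p * q)" if "g \<in> carrier G" for g p q
    using fr[OF that] by (simp add: pure_def scale) (simp add: tensor_rat_scale_def)
  have pure_mult: "pure (g \<otimes>\<^bsub>G\<^esub> h) q = pure g q \<oplus>\<^bsub>tensor_rat G\<^esub> pure h q"
    if "g \<in> carrier G" "h \<in> carrier G" for g h q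
  proof -
    have "frag_of (g \<otimes>\<^bsub>G\<^esub> h, q) - (frag_of (g, q) + frag_of (h, q)) \<in> tensor_rat_kernel G"
      unfolding tensor_rat_kernel_def using that
      by (intro generate.incl) (auto simp: tensor_rat_relations_def)
    then have "cl (frag_of (g, q) + frag_of (h, q)) = cl (frag_of (g \<otimes>\<^bsub>G\<^esub> h, q))"
      unfolding cl_def using F.m_closed[OF fr[OF that(1)] fr[OF that(2)]]
      by (intro tensor_rat_coset_eqI[OF m _ fr[OF G.m_closed[OF that]]]) (simp_all add: tensor_rat_free_def)
    then show ?thesis by (simp add: pure_def add[OF fr[OF that(1)] fr[OF that(2)]])
  qed
  define W where "W = V.span ((\<lambda>v. pure v 1) ` V)"
  have pV: "(\<lambda>v. pure v 1) ` V \<subseteq> carrier (tensor_rat G)" using assms(4) pure_mem by blast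
  interpret W: LinearCombinations.submodule "class_ring :: rat ring" W "tensor_rat G"
    unfolding W_def by (rule V.span_is_submodule[OF pV])
  have WV: "pure v 1 \<in> W" if "v \<in> V" for v
    using V.in_own_span[OF pV] that by (auto simp: W_def)
  have scl: "q \<odot>\<^bsub>tensor_rat G\<^esub> c \<in> W" if "c \<in> W" for q c
    using W.smult_closed[of q c] that by (simp add: class_ring_simps)
  have pure_one: "pure \<one>\<^bsub>G\<^esub> q = \<zero>\<^bsub>tensor_rat G\<^esub>" for q
    using pure_mult[OF G.one_closed G.one_closed, of q] pure_mem[OF G.one_closed]
    by (metis G.l_one G.one_closed V.M.add.l_cancel_one)
  have pure_pow: "pure (u [^]\<^bsub>G\<^esub> n) 1 = pure u (of_nat n)" if "u \<in> carrier G" for u and n :: nat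
  proof (induction n)
    case 0
    \<comment> \<open>The tensor of \<open>u\<close> with 0 is its own multiple by the scalar 0,
      hence zero, as is the tensor of the neutral element with 1.\<close>
    have "0 \<odot>\<^bsub>tensor_rat G\<^esub> pure u 0 = pure u 0" using pure_scale[OF that, of 0 0] by simp
    moreover have "0 \<odot>\<^bsub>tensor_rat G\<^esub> pure u 0 = \<zero>\<^bsub>tensor_rat G\<^esub>"
      using V.smult_l_null[OF pure_mem[OF that]] by (simp add: class_ring_simps)
    ultimately show ?case by (simp add: pure_one)
  next
    case (Suc n)
    have "pure u (of_nat n) \<oplus>\<^bsub>tensor_rat G\<^esub> pure u 1 =
      (of_nat n \<odot>\<^bsub>tensor_rat G\<^esub> pure u 1) \<oplus>\<^bsub>tensor_rat G\<^esub> (1 \<odot>\<^bsub>tensor_rat G\<^esub> pure u 1)"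
      using pure_scale[OF that] by simp
    also have "\<dots> = (of_nat n + 1) \<odot>\<^bsub>tensor_rat G\<^esub> pure u 1"
      using V.smult_l_distr[of "of_nat n" 1, OF _ _ pure_mem[OF that]] by (simp add: class_ring_simps)
    also have "\<dots> = pure u (of_nat (Suc n))" using pure_scale[OF that] by (simp add: add.commute)
    finally show ?case using Suc pure_mult[of "u [^]\<^bsub>G\<^esub> n" u 1] that by simp
  qed
  have gen: "pure g 1 \<in> W" if "g \<in> generate G V" for g
    using that
  proof induction
    case one
    show ?case by (simp add: pure_one)
  next
    case (incl h)
    then show ?case by (rule WV)
  next
    case (inv h)
    then have h: "h \<in> carrier G" using assms(4) by blast
    have "(-1) \<odot>\<^bsub>tensor_rat G\<^esub> pure h 1 = \<ominus>\<^bsub>tensor_rat G\<^esub> pure h 1"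
      using V.smult_minus_1[OF pure_mem[OF h]] by (simp add: class_ring_simps)
    moreover have "pure (inv\<^bsub>G\<^esub> h) 1 = \<ominus>\<^bsub>tensor_rat G\<^esub> pure h 1"
      using pure_mult[of "inv\<^bsub>G\<^esub> h" h 1] h pure_one
        V.M.minus_equality[of "pure (inv\<^bsub>G\<^esub> h) 1" "pure h 1"] pure_mem by simp
    ultimately show ?case using scl[OF WV[OF inv]] by metis
  next
    case (eng h1 h2)
    then have "h1 \<in> carrier G" "h2 \<in> carrier G"
      using G.generate_in_carrier[OF assms(4)] by auto
    then show ?case using eng.IH W.m_closed by (simp add: pure_mult)
  qed
  have all: "pure u q \<in> W" if u: "u \<in> carrier G" for u q
  proof -
    obtain n :: nat where n: "n > 0" "u [^]\<^bsub>G\<^esub> n \<in> generate G V" using power[OF u] by blast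
    \<comment> \<open>The exponent \<open>n\<close> is moved to the rational component, where it can
      be divided out.\<close>
    have "pure u (of_nat n) \<in> W" using gen[OF n(2)] pure_pow[OF u] by simp
    then have "(q / of_nat n) \<odot>\<^bsub>tensor_rat G\<^esub> pure u (of_nat n) \<in> W" by (rule scl)
    then show ?thesis using pure_scale[OF u] n(1) by simp
  qed
  \<comment> \<open>The generators yield the whole free group by differences, so the claim reduces
    to pure tensors.\<close>
  have "cl c \<in> W" if "c \<in> carrier (tensor_rat_free G)" for c
  proof -
    have "Poly_Mapping.keys c \<subseteq> carrier G \<times> UNIV" using that by (simp add: tensor_rat_free_def)
    then have "c \<in> carrier (tensor_rat_free G) \<and> cl c \<in> W"
    proof (induction c rule: frag_induction)
      case zero
      have "cl 0 = \<zero>\<^bsub>tensor_rat G\<^esub>"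
        using F.coset_mult_one[OF subgroup.subset[OF subgroup_tensor_rat_kernel[OF m]]]
        by (simp add: cl_def tensor_rat_def tensor_rat_free_def)
      then show ?case by (simp add: tensor_rat_free_def)
    next
      case (one x)
      then show ?case using all fr by (cases x) (auto simp: pure_def)
    next
      case (diff c d)
      then have c: "c \<in> carrier (tensor_rat_free G)" "d \<in> carrier (tensor_rat_free G)" "cl c \<in> W" "cl d \<in> W"
        by auto
      have cd: "c - d \<in> carrier (tensor_rat_free G)"
        using c(1,2) keys_diff[of c d] by (auto simp: tensor_rat_free_def)
      have "cl (c - d) \<oplus>\<^bsub>tensor_rat G\<^esub> cl d = cl c" using add[OF cd c(2)] by simp
      then have "cl (c - d) = cl c \<ominus>\<^bsub>tensor_rat G\<^esub> cl d"
        using cd c(1,2) car by (metis V.M.add.inv_solve_right a_minus_def image_eqI)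
      also have "\<dots> = cl c \<oplus>\<^bsub>tensor_rat G\<^esub> ((-1) \<odot>\<^bsub>tensor_rat G\<^esub> cl d)"
        using V.smult_minus_1[of "cl d"] c(2) by (simp add: a_minus_def car class_ring_simps)
      also have "\<dots> \<in> W" using c(3,4) scl by (intro W.m_closed)
      finally show ?case using cd by blast
    qed
    then show ?thesis ..
  qed
  then have "V.gen_set ((\<lambda>v. pure v 1) ` V)"
    using W.subset unfolding W_def[symmetric] car by blast
  then have "V.dim \<le> card ((\<lambda>v. pure v 1) ` V)"
    using assms(3) pV by (intro V.gen_ge_dim) auto
  also have "\<dots> \<le> card V" using assms(3) by (rule card_image_le)
  finally show ?thesis using assms(2) by (simp add: has_Z_rank_def)
qed

section \<open>Unit groups\<close>

text \<open>Carries the unit group over to the field. The group inverse is a definite description,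
  identified with \<open>inverse\<close> by uniqueness.\<close>

lemma units_of_ring_of_integersD:
  assumes "u \<in> carrier (units_of (ring_of_integers :: 'a::field_char_0 ring))"
  shows "u \<noteq> 0" "algebraic_int u" "algebraic_int (inverse u)"
    "inv\<^bsub>units_of ring_of_integers\<^esub> u = inverse u"
proof -
  have u: "algebraic_int u" "\<exists>y. algebraic_int y \<and> y * u = 1"
    using assms by (auto simp: units_of_def Units_def ring_of_integers_def)
  then obtain y where y: "algebraic_int y" "y * u = 1" by blast
  then have "y = inverse u" using inverse_unique[of u y] by (simp add: mult.commute)
  with y u show 0: "u \<noteq> 0" "algebraic_int u" "algebraic_int (inverse u)" by auto
  have "inverse u \<in> carrier (units_of ring_of_integers)"
    using 0 by (auto simp: units_of_def Units_def ring_of_integers_def intro!: bexI[of _ u])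
  then show "inv\<^bsub>units_of ring_of_integers\<^esub> u = inverse u"
    unfolding m_inv_def using 0(1)
    by (intro the_equality) (auto simp: units_of_def ring_of_integers_def inverse_unique)
qed

lemma comm_group_units_subgroup:
  assumes "subgroup U (units_of (ring_of_integers :: 'a::field_char_0 ring))"
  shows "comm_group ((units_of (ring_of_integers :: 'a ring))\<lparr>carrier := U\<rparr>)"
proof -
  interpret subgroup U "units_of (ring_of_integers :: 'a ring)" by fact
  have mem: "u \<in> carrier (units_of ring_of_integers)" if "u \<in> U" for u using subset that by blast
  have inv: "inverse u \<in> U" "u \<noteq> 0" if "u \<in> U" for u
    using m_inv_closed[OF that] units_of_ring_of_integersD[OF mem[OF that]] by simp_all
  have one: "1 \<in> U" using one_closed by (simp add: units_of_def ring_of_integers_def)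
  have mult: "x * y \<in> U" if "x \<in> U" "y \<in> U" for x y
    using m_closed[OF that] by (simp add: units_of_def ring_of_integers_def)
  show ?thesis
  proof (rule comm_groupI)
    fix x assume "x \<in> carrier ((units_of (ring_of_integers :: 'a ring))\<lparr>carrier := U\<rparr>)"
    then have "inverse x \<in> U" "inverse x * x = 1" using inv[of x] by simp_all
    then show "\<exists>y\<in>carrier ((units_of ring_of_integers)\<lparr>carrier := U\<rparr>).
        y \<otimes>\<^bsub>(units_of ring_of_integers)\<lparr>carrier := U\<rparr>\<^esub> x = \<one>\<^bsub>(units_of ring_of_integers)\<lparr>carrier := U\<rparr>\<^esub>"
      by (intro bexI[of _ "inverse x"]) (simp_all add: units_of_def ring_of_integers_def)
  qed (use one mult in \<open>simp_all add: units_of_def ring_of_integers_def ac_simps\<close>)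
qed

lemma bij_betw_embeddings:
  fixes s t :: nat and \<sigma> :: "nat \<Rightarrow> 'a::field_char_0 \<Rightarrow> complex"
  assumes "bij_betw \<sigma> {1..s} real_embeddings" "bij_betw \<sigma> {s+1..s+2*t} nonreal_embeddings"
  shows "bij_betw \<sigma> {1..s+2*t} embeddings"
proof -
  have "bij_betw \<sigma> ({1..s} \<union> {s+1..s+2*t}) (real_embeddings \<union> nonreal_embeddings)"
    using assms by (rule bij_betw_combine) (auto simp: real_embeddings_def nonreal_embeddings_def)
  moreover have "{1..s} \<union> {s+1..s+2*t} = {1..s+2*t}" by auto
  moreover have "real_embeddings \<union> nonreal_embeddings = (embeddings :: ('a \<Rightarrow> complex) set)"
    by (auto simp: real_embeddings_def nonreal_embeddings_def embeddings_def)
  ultimately show ?thesis by simp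
qed

text \<open>Eliminating \<open>y\<close> leaves \<open>x\<close> with the coefficient \<open>n + c3 + c4 - c2 \<ge> 1\<close>.\<close>

lemma abs_le_if_relations:
  fixes x y :: real and c2 c3 c4 :: real
  assumes n: "n \<ge> 2" and c: "c2 \<in> {0, 1}" "c3 \<in> {0, 1}" "c4 \<in> {0, 1}"
    and r: "\<bar>r2\<bar> \<le> M" "\<bar>r3\<bar> \<le> M" "\<bar>r4\<bar> \<le> M"
    and total: "x + S + n * y = 0"
    and rel: "x + (c2 * y + r2) = (c3 * y + r3) + (c4 * y + r4)"
  shows "\<bar>x\<bar> \<le> 2 * \<bar>S\<bar> + 3 * n * M" "\<bar>y\<bar> \<le> \<bar>x\<bar> + \<bar>S\<bar>"
proof -
  define c where "c = c3 + c4 - c2"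
  define R where "R = r3 + r4 - r2"
  have c: "-1 \<le> c" "c \<le> 2" "\<bar>c\<bar> \<le> 2" using c by (auto simp: c_def)
  have R: "\<bar>R\<bar> \<le> 3 * M" using r by (simp add: R_def)
  have x: "x = c * y + R" using rel by (simp add: c_def R_def algebra_simps)
  \<comment> \<open>After multiplication by \<open>n\<close>, \<open>y\<close> occurs only as
    \<open>n * y\<close>, which \<open>total\<close> expresses by \<open>x\<close> and
    \<open>S\<close>.\<close>
  have "(n + c) * x = n * x + c * x" by (simp add: algebra_simps)
  also have "n * x = c * (n * y) + n * R" by (subst x) (simp add: algebra_simps)
  also have "n * y = - x - S" using total by simp
  finally have eq: "(n + c) * x = n * R - c * S" by (simp add: algebra_simps)
  have "\<bar>x\<bar> \<le> \<bar>(n + c) * x\<bar>"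
    using n c unfolding abs_mult by (simp add: mult_le_cancel_right1)
  also have "\<dots> \<le> \<bar>n * R\<bar> + \<bar>c * S\<bar>" unfolding eq by (rule abs_triangle_ineq4)
  also have "\<dots> \<le> n * (3 * M) + 2 * \<bar>S\<bar>"
    using R c n unfolding abs_mult by (intro add_mono mult_mono) auto
  finally show "\<bar>x\<bar> \<le> 2 * \<bar>S\<bar> + 3 * n * M" by simp
  have "\<bar>y\<bar> \<le> n * \<bar>y\<bar>" using n by (simp add: mult_le_cancel_right1)
  also have "\<dots> = \<bar>n * y\<bar>" using n by (simp add: abs_mult)
  also have "n * y = - x - S" using total by simp
  finally show "\<bar>y\<bar> \<le> \<bar>x\<bar> + \<bar>S\<bar>" by linarith
qed

theorem theorem3p1:
  fixes s t :: nat
    and \<sigma> :: "nat \<Rightarrow> 'a::field_char_0 \<Rightarrow> complex"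
    and U :: "'a set"
  assumes "number_field TYPE('a)"
    and "s \<ge> 1" and "t \<ge> 1"
    and "bij_betw \<sigma> {1..s} real_embeddings"
    and "bij_betw \<sigma> {s+1..s+2*t} nonreal_embeddings"
    and "\<forall>k\<in>{1..t}. \<forall>x. \<sigma> (s + t + k) x = cnj (\<sigma> (s + k) x)"
    and "subgroup U (units_of ring_of_integers)"
    and "has_Z_rank ((units_of ring_of_integers)\<lparr>carrier := U\<rparr>) s"
    and "\<forall>u\<in>U. \<forall>i\<in>{1..t}. \<forall>j\<in>{1..t}. cmod (\<sigma> (s + i) u) = cmod (\<sigma> (s + j) u)"
  shows "t = 1"
proof (rule ccontr)
  assume "t \<noteq> 1"
  with assms(3) have t: "t \<ge> 2" by simp
  let ?G = "(units_of (ring_of_integers :: 'a ring))\<lparr>carrier := U\<rparr>"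
  let ?n = "s + 2 * t"
  have \<sigma>: "bij_betw \<sigma> {1..?n} embeddings" by (rule bij_betw_embeddings[OF assms(4,5)])
  obtain B :: "'a set" where B: "finite B" "Modules.module.span (\<lambda>(q::rat) x. of_rat q * x) B = UNIV"
    using assms(1) by (auto simp: number_field_def)
  interpret embedded_number_field B
    by standard (use B bij_betw_finite[OF \<sigma>] in auto)
  interpret G: comm_group ?G by (rule comm_group_units_subgroup[OF assms(7)])
  have unit: "u \<noteq> 0" "algebraic_int u" "algebraic_int (inverse u)" if "u \<in> U" for u
    using units_of_ring_of_integersD[of u] subgroup.subset[OF assms(7)] that by blast+
  have emb: "\<sigma> j \<in> embeddings" if "j \<in> {1..?n}" for j
    using bij_betwE[OF \<sigma>] that by blast
  have nz: "\<sigma> j u \<noteq> 0" if "j \<in> {1..?n}" "u \<in> U" for j u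
    using emb[OF that(1)] inj_field_hom[of "\<sigma> j"] field_hom_of_rat[of "\<sigma> j" 0] unit(1)[OF that(2)]
    by (auto simp: embeddings_def dest: injD[of "\<sigma> j" u 0])
  define a where "a j u = ln (cmod (\<sigma> j u))" for j u
  have character: "real_character ?G (a j)" if j: "j \<in> {1..?n}" for j
  proof
    fix x y assume "x \<in> carrier ?G" "y \<in> carrier ?G"
    then have xy: "x \<in> U" "y \<in> U" by simp_all
    interpret field_hom "\<sigma> j" using emb[OF j] by (simp add: embeddings_def)
    show "a j (x \<otimes>\<^bsub>?G\<^esub> y) = a j x + a j y"
      using nz[OF j xy(1)] nz[OF j xy(2)]
      by (simp add: a_def units_of_def ring_of_integers_def hom_mult norm_mult ln_mult)
  qed
  have total: "(\<Sum>j=1..?n. a j u) = 0" if u: "u \<in> U" for u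
  proof -
    have "(\<Sum>j=1..?n. a j u) = (\<Sum>f\<in>embeddings. ln (cmod (f u)))"
      unfolding a_def by (rule sum.reindex_bij_betw[OF \<sigma>, of "\<lambda>f. ln (cmod (f u))"])
    also have "\<dots> = ln (\<Prod>f\<in>embeddings. cmod (f u))"
    proof (rule ln_prod[symmetric])
      fix f :: "'a \<Rightarrow> complex" assume "f \<in> embeddings"
      then obtain j where "j \<in> {1..?n}" "f = \<sigma> j" using bij_betw_imp_surj_on[OF \<sigma>] by blast
      then show "cmod (f u) \<noteq> 0" using nz u by simp
    qed (rule finite_embeddings)
    finally show ?thesis using prod_embeddings_unit unit u by simp
  qed
  \<comment> \<open>The labels above \<open>s + t\<close> belong to complex conjugates of those in
    \<open>s+1..s+t\<close>, with equal absolute values.\<close>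
  have nonreal: "a j u = a (s + 1) u" if "j \<in> {s+1..?n}" "u \<in> U" for j u
  proof -
    have *: "a (s + k) u = a (s + 1) u" if "k \<in> {1..t}" for k
      using assms(9)[rule_format, OF \<open>u \<in> U\<close> that, of 1] t by (simp add: a_def)
    consider k where "k \<in> {1..t}" "j = s + k" | k where "k \<in> {1..t}" "j = s + t + k"
    proof (cases "j \<le> s + t")
      case True
      then have "j - s \<in> {1..t}" "j = s + (j - s)" using \<open>j \<in> {s+1..?n}\<close> by auto
      then show ?thesis by (rule that(1))
    next
      case False
      then have "j - s - t \<in> {1..t}" "j = s + t + (j - s - t)" using \<open>j \<in> {s+1..?n}\<close> by auto
      then show ?thesis by (rule that(2))
    qed
    then show ?thesis
    proof cases
      case 2
      then have "a j u = a (s + k) u" using assms(6)[rule_format, of k u] by (simp add: a_def)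
      then show ?thesis using * 2 by simp
    qed (use * in simp)
  qed
  \<comment> \<open>For \<open>s = 1\<close> the middle sum is empty.\<close>
  have total': "a 1 u + (\<Sum>j=2..s. a j u) + real (2 * t) * a (s + 1) u = 0" if u: "u \<in> U" for u
  proof -
    have "(\<Sum>j=1..?n. a j u) = (\<Sum>j=1..s. a j u) + (\<Sum>j=s+1..?n. a j u)"
      by (subst sum.ub_add_nat) simp_all
    also have "(\<Sum>j=s+1..?n. a j u) = (\<Sum>j=s+1..?n. a (s + 1) u)"
      by (intro sum.cong refl nonreal[OF _ u])
    also have "(\<Sum>j=1..s. a j u) = a 1 u + (\<Sum>j=2..s. a j u)"
      using assms(2) by (simp add: sum.atLeast_Suc_atMost numeral_2_eq_2)
    finally show ?thesis using total[OF u] by simp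
  qed
  obtain \<pi> where \<pi>: "bij_betw \<pi> embeddings embeddings" "\<pi> (\<sigma> (s + 1)) = \<sigma> 1"
    "\<And>h1 h2 h3 h4 u. {h1, h2, h3, h4} \<subseteq> embeddings \<Longrightarrow> h1 u * h2 u = h3 u * h4 u \<Longrightarrow>
       \<pi> h1 (u::'a) * \<pi> h2 u = \<pi> h3 u * \<pi> h4 u"
    using transitive_on_embeddings[OF emb emb, of "s + 1" 1] assms(2) t by auto
  \<comment> \<open>By injectivity only \<open>\<sigma> (s + 1)\<close> goes to
    \<open>\<sigma> 1\<close>, so the other three terms of the relation below never involve
    \<open>a 1\<close>.\<close>
  have image: "\<exists>p\<in>{2..?n}. \<pi> (\<sigma> j) = \<sigma> p" if j: "j \<in> {1..?n}" "j \<noteq> s + 1" for j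
  proof -
    have "\<pi> (\<sigma> j) \<in> \<sigma> ` {1..?n}"
      using bij_betwE[OF \<pi>(1)] emb[OF j(1)] bij_betw_imp_surj_on[OF \<sigma>] by blast
    then obtain p where p: "p \<in> {1..?n}" "\<pi> (\<sigma> j) = \<sigma> p" by blast
    have "\<sigma> j \<noteq> \<sigma> (s + 1)"
      using j t inj_onD[OF bij_betw_imp_inj_on[OF \<sigma>], of j "s + 1"] by auto
    then have "\<pi> (\<sigma> j) \<noteq> \<pi> (\<sigma> (s + 1))"
      using inj_onD[OF bij_betw_imp_inj_on[OF \<pi>(1)]] emb j(1) t by auto
    then have "p \<noteq> 1" using p(2) \<pi>(2) by auto
    then show ?thesis using p by (intro bexI[of _ p]) auto
  qed
  \<comment> \<open>Here \<open>t \<ge> 2\<close> enters: it puts \<open>s + 2\<close> and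
    \<open>s + t + 2\<close> among the labels.\<close>
  obtain p2 where p2: "p2 \<in> {2..?n}" "\<pi> (\<sigma> (s + t + 1)) = \<sigma> p2" using image[of "s + t + 1"] t by auto
  obtain p3 where p3: "p3 \<in> {2..?n}" "\<pi> (\<sigma> (s + 2)) = \<sigma> p3" using image[of "s + 2"] t by auto
  obtain p4 where p4: "p4 \<in> {2..?n}" "\<pi> (\<sigma> (s + t + 2)) = \<sigma> p4" using image[of "s + t + 2"] t by auto
  have relation: "a 1 u + a p2 u = a p3 u + a p4 u" if u: "u \<in> U" for u
  proof -
    have sq: "\<sigma> (s + k) u * \<sigma> (s + t + k) u = of_real ((cmod (\<sigma> (s + k) u))\<^sup>2)" if "k \<in> {1..t}" for k
      using assms(6)[rule_format, OF that, of u] by (simp only: complex_norm_square)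
    have "cmod (\<sigma> (s + 1) u) = cmod (\<sigma> (s + 2) u)" using assms(9)[rule_format, OF u, of 1 2] t by simp
    then have "\<sigma> (s + 1) u * \<sigma> (s + t + 1) u = \<sigma> (s + 2) u * \<sigma> (s + t + 2) u"
      using sq[of 1] sq[of 2] t by simp
    then have "\<sigma> 1 u * \<sigma> p2 u = \<sigma> p3 u * \<sigma> p4 u"
      using \<pi>(3)[of "\<sigma> (s + 1)" "\<sigma> (s + t + 1)" "\<sigma> (s + 2)" "\<sigma> (s + t + 2)" u] emb t \<pi>(2) p2 p3 p4
      by simp
    then have "ln (cmod (\<sigma> 1 u) * cmod (\<sigma> p2 u)) = ln (cmod (\<sigma> p3 u) * cmod (\<sigma> p4 u))"
      by (metis norm_mult)
    moreover have "\<sigma> j u \<noteq> 0" if "j \<in> {1, p2, p3, p4}" for j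
      using that nz[OF _ u] p2(1) p3(1) p4(1) assms(2) by auto
    ultimately show ?thesis by (simp add: a_def ln_mult)
  qed
  have discrete: "finite {u \<in> carrier ?G. \<forall>j\<in>{2..s}. \<bar>a j u\<bar> \<le> M}" for M
  proof -
    define S where "S = real s * \<bar>M\<bar>"
    \<comment> \<open>\<open>S\<close> bounds the sum of the \<open>s - 1\<close> controlled
      logarithms. The first two summands of \<open>C\<close> cover \<open>a 1\<close> and the common
      value on the non-real embeddings, the last one covers the indices in \<open>{2..s}\<close>.
      Absolute values guard against negative \<open>M\<close>.\<close>
    define C where "C = 3 * S + 3 * real (2 * t) * \<bar>M\<bar> + \<bar>M\<bar>"
    have nonneg: "S \<ge> 0" "3 * real (2 * t) * \<bar>M\<bar> \<ge> 0" "\<bar>M\<bar> \<ge> 0" by (simp_all add: S_def)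
    have "cmod (\<sigma> j u) \<le> exp C"
      if u: "u \<in> U" "\<forall>j\<in>{2..s}. \<bar>a j u\<bar> \<le> M" and j: "j \<in> {1..?n}" for u j
    proof -
      \<comment> \<open>\<open>c\<close> and \<open>r\<close> write every \<open>a p\<close> with
        \<open>p \<ge> 2\<close> uniformly as a multiple of \<open>a (s + 1)\<close> plus a bounded
        rest: the real embeddings have \<open>c p = 0\<close>, the non-real ones
        \<open>r p = 0\<close>.\<close>
      define c where "c p = (if p \<le> s then 0 else 1 :: real)" for p
      define r where "r p = (if p \<le> s then a p u else 0)" for p
      have M: "\<bar>a i u\<bar> \<le> \<bar>M\<bar>" if "i \<in> {2..s}" for i using u(2) that by force
      have r: "\<bar>r p\<bar> \<le> \<bar>M\<bar>" if "p \<in> {2..?n}" for p using M that by (simp add: r_def)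
      have a: "a p u = c p * a (s + 1) u + r p" if "p \<in> {2..?n}" for p
        using nonreal[of p] u(1) that by (simp add: c_def r_def)
      have "\<bar>\<Sum>j=2..s. a j u\<bar> \<le> (\<Sum>j=2..s. \<bar>M\<bar>)"
        using M by (intro order_trans[OF sum_abs] sum_mono)
      also have "\<dots> \<le> S" by (simp add: S_def mult_right_mono)
      finally have S: "\<bar>\<Sum>j=2..s. a j u\<bar> \<le> S" .
      have rel: "a 1 u + (c p2 * a (s + 1) u + r p2) =
          (c p3 * a (s + 1) u + r p3) + (c p4 * a (s + 1) u + r p4)"
        using relation[OF u(1)] a[OF p2(1)] a[OF p3(1)] a[OF p4(1)] by simp
      have "real (2 * t) \<ge> 2" using t by simp
      from abs_le_if_relations[OF this _ _ _ r[OF p2(1)] r[OF p3(1)] r[OF p4(1)] total'[OF u(1)] rel]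
      have "\<bar>a 1 u\<bar> \<le> 2 * \<bar>\<Sum>j=2..s. a j u\<bar> + 3 * real (2 * t) * \<bar>M\<bar>"
        "\<bar>a (s + 1) u\<bar> \<le> \<bar>a 1 u\<bar> + \<bar>\<Sum>j=2..s. a j u\<bar>"
        by (simp_all add: c_def)
      then have 1: "\<bar>a 1 u\<bar> \<le> C" "\<bar>a (s + 1) u\<bar> \<le> C"
        using S nonneg unfolding C_def by linarith+
      have "\<bar>M\<bar> \<le> C" using nonneg unfolding C_def by linarith
      then have "\<bar>a j u\<bar> \<le> C"
        using 1 M[of j] nonreal[of j u] j u(1) by (cases "j = 1"; cases "j \<le> s") auto
      then have "a j u \<le> C" by simp
      then have "exp (a j u) \<le> exp C" by simp
      then show ?thesis using nz[OF j u(1)] by (simp add: a_def)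
    qed
    then have "cmod (f u) \<le> exp C"
      if "u \<in> U" "\<forall>j\<in>{2..s}. \<bar>a j u\<bar> \<le> M" "f \<in> embeddings" for f u
      using that unfolding bij_betw_imp_surj_on[OF \<sigma>, symmetric] by auto
    then have "{u \<in> carrier ?G. \<forall>j\<in>{2..s}. \<bar>a j u\<bar> \<le> M}
        \<subseteq> {u. algebraic_int u \<and> (\<forall>f\<in>embeddings. cmod (f u) \<le> exp C)}"
      using unit by auto
    moreover have "(embeddings :: ('a \<Rightarrow> complex) set) \<noteq> {}" using emb[of 1] assms(2) by auto
    ultimately show ?thesis using finite_bounded_algebraic_ints finite_subset by blast
  qed
  \<comment> \<open>The index set \<open>{2..s}\<close> has \<open>s - 1\<close> elements, one fewer
    than the assumed rank.\<close>
  obtain V where V: "V \<subseteq> carrier ?G" "finite V" "card V \<le> card {2..s}"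
    "\<forall>u\<in>carrier ?G. \<exists>n>0. u [^]\<^bsub>?G\<^esub> (n::nat) \<in> generate ?G V"
    using G.torsion_mod_generate_if_discrete[of "{2..s}" a] character discrete by auto
  then have "s \<le> card V"
    using has_Z_rank_le[OF G.comm_group_axioms assms(8)] by blast
  then show False using V(3) assms(2) by simp
qed

end
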